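(* Let $T_0$ be a finite set of primitive tests, $\mathcal A_0$ a finite set of primitive choices, $\mathcal T$ a theory, and let $C\subseteq\mathcal A^+_{\mathcal A_0,T_0}$ be closed and mixture-closed. A preference relation $\succeq$ on $C$ has a constructive $\mathcal T$-consistent SEU representation if and only if $\succeq$ satisfies $\mathbf{A2^\dagger}$ and $\mathbf{A3}$. Moreover, in the representation, either $\mathcal P$ or $\mathcal U$ can be taken to be a singleton and, if $\mathcal U$ is a singleton $\{u\}$, the state space can be taken to be $\mathrm{At}_{\mathcal T}(T_0)\times EX^+_{\mathrm{AX}}(\succeq)$. If, in addition, $\succeq$ satisfies $\mathbf{A1}$ ($\succeq$ is complete), then $\mathcal V$ can be taken to be a singleton.
   Context: **Tests.** $T$ is the smallest set containing the finite set $T_0$ of primitive tests and closed under $\wedge$ and $\neg$. A theory is a set $\mathcal T\subseteq T$. **Choices.** $\mathcal A^+_{\mathcal A_0,T_0}$ is the smallest set of syntactic expressions containing the finite set $\mathcal A_0$ such that if $t\in T$, $r\in[0,1]$ and $a,b$ are in the set, so are "$\mathbf{if}\ t\ \mathbf{then}\ a\ \mathbf{else}\ b$" and "$ra+(1-r)b$". $C$ is mixture-closed if $a,b\in C$, $r\in[0,1]$ imply $ra+(1-r)b\in C$. A preference relation on $C$ is a binary relation on $C$, not assumed complete or transitive. **Interpretations.** A (standard) test interpretation for a set $S$ is a map $\pi_S:T\to 2^S$ with $\pi_S(t_1\wedge t_2)=\pi_S(t_1)\cap\pi_S(t_2)$ and $\pi_S(\neg t)=S\setminus\pi_S(t)$;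 it respects (is consistent with) $\mathcal T$ if $\pi_S(t)=S$ for all $t\in\mathcal T$. Let $\Delta(O)$ be the set of probability measures on $O$ and $\Delta^*(O)$ the subset of point masses. Given $\pi_S$ and $\rho^0_{SO}:\mathcal A_0\to\Delta^*(O)^S$, the choice interpretation $\rho_{SO}:\mathcal A^+_{\mathcal A_0,T_0}\to\Delta(O)^S$ compatible with $\pi_S$ extends $\rho^0_{SO}$ by $\rho_{SO}(\mathbf{if}\ t\ \mathbf{then}\ a_1\ \mathbf{else}\ a_2)(s)=\rho_{SO}(a_1)(s)$ if $s\in\pi_S(t)$, $=\rho_{SO}(a_2)(s)$ otherwise, and $\rho_{SO}(ra_1+(1-r)a_2)(s)=r\rho_{SO}(a_1)(s)+(1-r)\rho_{SO}(a_2)(s)$. **Atoms.** If $T_0=\{t_1,\dots,t_n\}$, an atom is a test $t_1'\wedge\dots\wedge t_n'$ with each $t_i'\in\{t_i,\neg t_i\}$; $\mathrm{At}(T_0)$ is the set of atoms. $\delta\Rightarrow t$ means $\pi_S(\delta)\subseteq\pi_S(t)$ for all $S$ and all standard $\pi_S$. $\mathrm{At}_{\mathcal T}(T_0)$ is the set of atoms $\delta$ consistent with $\mathcal T$, i.e. such that $\pi_S(\delta)\ne\emptyset$ for some $S$ and some standard $\pi_S$ respecting $\mathcal T$. **The functions $f_a$** from atoms to distributions on $\mathcal A_0$: for $a\in\mathcal A_0$, $f_a$ is constantly the point mass at $a$; $f_{\mathbf{if}\ t\ \mathbf{then}\ a\ \mathbf{else}\ b}(\delta)=f_a(\delta)$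 if $\delta\Rightarrow t$ and $f_b(\delta)$ otherwise; $f_{ra+(1-r)b}(\delta)=rf_a(\delta)+(1-r)f_b(\delta)$. Via $a\mapsto f_a$, a choice is identified with a vector in $\mathbb R^{\mathrm{At}(T_0)\times\mathcal A_0}$; closedness of $C$ and of the graph of $\succeq$ refer to this identification. **$\mathbf{A2^\dagger}$.** If $\langle a_1,\dots,a_n\rangle$ and $\langle b_1,\dots,b_n\rangle$ are sequences of choices in $C$ with $f_{a_1}(\delta)+\dots+f_{a_n}(\delta)=f_{b_1}(\delta)+\dots+f_{b_n}(\delta)$ for all $\delta\in\mathrm{At}_{\mathcal T}(T_0)$, and there is $k<n$ ($k\ge 0$) with $a_i\succeq b_i$ for $i\le k$, $a_{k+1}=\dots=a_n$, and $b_{k+1}=\dots=b_n$, then $b_n\succeq a_n$. **$\mathbf{A3}$.** The graph of $\succeq$, i.e. the set of pairs $(a,b)$ with $a\succeq b$, is closed. **$EX^+_{\mathrm{AX}}(\succeq)$** is the set of all complete preference relations on $C$ that extend $\succeq$ and satisfy $\mathbf{A2^\dagger}$ and $\mathbf{A3}$. **Representation.** $\succeq$ on $C$ has a constructive $\mathcal T$-consistent SEU representation iff there are a finite set $S$ of states, a finite set $O$ of outcomes, a set $\mathcal U$ of utility functions $u:O\to\mathbb R$, a closed set $\mathcal P$ of probability distributions on $S$, a closed set $\mathcal V\subseteq\mathcal U\times\mathcal P$, a test interpretation $\pi_S$ consistent with $\mathcal T$, and a choice interpretation $\rho_{SO}$ (compatible with $\pi_S$) such that $a\succeq b$ iff $\sum_{s,o}u(o)\rho_{SO}(a)(s)(o)p(s)\ge\sum_{s,o}u(o)\rho_{SO}(b)(s)(o)p(s)$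 for all $(u,p)\in\mathcal V$.
   Formalization: For the state space At_T(T_0) × EX^+(≽), which is infinite in general, S is not required to be finite (distributions on S are then discrete); that P or V can be a singleton is claimed only when At_T(T_0) is nonempty, since otherwise S is empty and carries no probability. *)

theory Defs
  imports "HOL-Analysis.Analysis"
begin

datatype 'p test = Prim 'p | And "'p test" "'p test" | Neg "'p test"

inductive_set tests :: "'p set \<Rightarrow> 'p test set" for T0 where
  "p \<in> T0 \<Longrightarrow> Prim p \<in> tests T0"
| "t1 \<in> tests T0 \<Longrightarrow> t2 \<in> tests T0 \<Longrightarrow> And t1 t2 \<in> tests T0"
| "t \<in> tests T0 \<Longrightarrow> Neg t \<in> tests T0"

text \<open>\<open>Mix r a b\<close> is the formal expression \<open>r a + (1 - r) b\<close>.\<close>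

datatype ('p, 'c) choice =
    Basic 'c
  | Ite "'p test" "('p, 'c) choice" "('p, 'c) choice"
  | Mix real "('p, 'c) choice" "('p, 'c) choice"

inductive_set choices :: "'p set \<Rightarrow> 'c set \<Rightarrow> ('p, 'c) choice set" for T0 A0 where
  "c \<in> A0 \<Longrightarrow> Basic c \<in> choices T0 A0"
| "t \<in> tests T0 \<Longrightarrow> a \<in> choices T0 A0 \<Longrightarrow> b \<in> choices T0 A0 \<Longrightarrow> Ite t a b \<in> choices T0 A0"
| "0 \<le> r \<Longrightarrow> r \<le> 1 \<Longrightarrow> a \<in> choices T0 A0 \<Longrightarrow> b \<in> choices T0 A0 \<Longrightarrow> Mix r a b \<in> choices T0 A0"

definition mixture_closed :: "('p, 'c) choice set \<Rightarrow> bool" where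
  "mixture_closed C \<longleftrightarrow> (\<forall>a\<in>C. \<forall>b\<in>C. \<forall>r\<in>{0..1}. Mix r a b \<in> C)"

definition test_interp :: "'p set \<Rightarrow> 's set \<Rightarrow> ('p test \<Rightarrow> 's set) \<Rightarrow> bool" where
  "test_interp T0 S \<pi> \<longleftrightarrow>
     (\<forall>t\<in>tests T0. \<pi> t \<subseteq> S) \<and>
     (\<forall>t1\<in>tests T0. \<forall>t2\<in>tests T0. \<pi> (And t1 t2) = \<pi> t1 \<inter> \<pi> t2) \<and>
     (\<forall>t\<in>tests T0. \<pi> (Neg t) = S - \<pi> t)"

definition respects_theory :: "'s set \<Rightarrow> ('p test \<Rightarrow> 's set) \<Rightarrow> 'p test set \<Rightarrow> bool" where
  "respects_theory S \<pi> Th \<longleftrightarrow> (\<forall>t\<in>Th. \<pi> t = S)"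

text \<open>An atom, i.e. a conjunction of literals with one literal for each primitive test, is
  represented by the set of its conjuncts. This avoids fixing an enumeration of \<open>T0\<close>, and it
  provides the empty conjunction (interpreted as all of \<open>S\<close>) as the only atom when \<open>T0\<close> is
  empty, in which case there are no tests at all.\<close>

type_synonym 'p atom = "'p test set"

definition atoms :: "'p set \<Rightarrow> 'p atom set" where
  "atoms T0 = {(\<lambda>p. if p \<in> X then Prim p else Neg (Prim p)) ` T0 | X. X \<subseteq> T0}"

definition atom_interp :: "'s set \<Rightarrow> ('p test \<Rightarrow> 's set) \<Rightarrow> 'p atom \<Rightarrow> 's set" where
  "atom_interp S \<pi> \<delta> = {s \<in> S. \<forall>l\<in>\<delta>. s \<in> \<pi> l}"

text \<open>In the next two definitions it suffices to let \<open>S\<close> range over sets of natural numbers: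
  a state witnessing the failure of an entailment, or the consistency of an atom, in an
  interpretation over any \<open>S\<close> still does so after \<open>S\<close> is restricted to that single state.\<close>

definition entails :: "'p set \<Rightarrow> 'p atom \<Rightarrow> 'p test \<Rightarrow> bool" where
  "entails T0 \<delta> t \<longleftrightarrow>
     (\<forall>(S::nat set) \<pi>. test_interp T0 S \<pi> \<longrightarrow> atom_interp S \<pi> \<delta> \<subseteq> \<pi> t)"

definition consistent_atoms :: "'p set \<Rightarrow> 'p test set \<Rightarrow> 'p atom set" where
  "consistent_atoms T0 Th =
     {\<delta> \<in> atoms T0. \<exists>(S::nat set) \<pi>. test_interp T0 S \<pi> \<and> respects_theory S \<pi> Th \<and>
        atom_interp S \<pi> \<delta> \<noteq> {}}"

primrec choice_fun :: "'p set \<Rightarrow> ('p, 'c) choice \<Rightarrow> 'p atom \<Rightarrow> 'c \<Rightarrow> real" where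
  "choice_fun T0 (Basic c) \<delta> = indicator {c}"
| "choice_fun T0 (Ite t a b) \<delta> =
     (if entails T0 \<delta> t then choice_fun T0 a \<delta> else choice_fun T0 b \<delta>)"
| "choice_fun T0 (Mix r a b) \<delta> =
     (\<lambda>c. r * choice_fun T0 a \<delta> c + (1 - r) * choice_fun T0 b \<delta> c)"

text \<open>The vector in \<open>\<real>\<close> to the power \<open>atoms T0 \<times> A0\<close> identified with a choice, as a function on
  the whole type that vanishes off \<open>atoms T0 \<times> A0\<close> (for choices over \<open>T0\<close> and \<open>A0\<close>). Since
  \<open>T0\<close> and \<open>A0\<close> are finite, closedness in the product topology used by \<open>closed\<close> on functions is
  Euclidean closedness.\<close>

definition choice_vec :: "'p set \<Rightarrow> ('p, 'c) choice \<Rightarrow> 'p atom \<times> 'c \<Rightarrow> real" where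
  "choice_vec T0 a = (\<lambda>(\<delta>, c). if \<delta> \<in> atoms T0 then choice_fun T0 a \<delta> c else 0)"

definition closed_choices :: "'p set \<Rightarrow> ('p, 'c) choice set \<Rightarrow> bool" where
  "closed_choices T0 C \<longleftrightarrow> closed (choice_vec T0 ` C)"

text \<open>A preference relation on \<open>C\<close> is a set \<open>R \<subseteq> C \<times> C\<close>; \<open>(a, b) \<in> R\<close> means that \<open>a\<close> is weakly
  preferred to \<open>b\<close>.\<close>

type_synonym ('p, 'c) pref = "(('p, 'c) choice \<times> ('p, 'c) choice) set"

definition A1 :: "('p, 'c) choice set \<Rightarrow> ('p, 'c) pref \<Rightarrow> bool" where
  "A1 C R \<longleftrightarrow> (\<forall>a\<in>C. \<forall>b\<in>C. (a, b) \<in> R \<or> (b, a) \<in> R)"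

definition A2_dagger ::
  "'p set \<Rightarrow> 'p test set \<Rightarrow> ('p, 'c) choice set \<Rightarrow> ('p, 'c) pref \<Rightarrow> bool" where
  "A2_dagger T0 Th C R \<longleftrightarrow>
     (\<forall>(n::nat) (k::nat) a b.
        k < n \<longrightarrow>
        (\<forall>i\<in>{1..n}. a i \<in> C \<and> b i \<in> C) \<longrightarrow>
        (\<forall>\<delta>\<in>consistent_atoms T0 Th. \<forall>c.
           (\<Sum>i=1..n. choice_fun T0 (a i) \<delta> c) = (\<Sum>i=1..n. choice_fun T0 (b i) \<delta> c)) \<longrightarrow>
        (\<forall>i\<in>{1..k}. (a i, b i) \<in> R) \<longrightarrow>
        (\<forall>i\<in>{k+1..n}. a i = a n \<and> b i = b n) \<longrightarrow>
        (b n, a n) \<in> R)"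

definition A3 :: "'p set \<Rightarrow> ('p, 'c) pref \<Rightarrow> bool" where
  "A3 T0 R \<longleftrightarrow> closed ((\<lambda>(a, b). (choice_vec T0 a, choice_vec T0 b)) ` R)"

definition EX_AX ::
  "'p set \<Rightarrow> 'p test set \<Rightarrow> ('p, 'c) choice set \<Rightarrow> ('p, 'c) pref \<Rightarrow> ('p, 'c) pref set" where
  "EX_AX T0 Th C R =
     {R'. R' \<subseteq> C \<times> C \<and> A1 C R' \<and> R \<subseteq> R' \<and> A2_dagger T0 Th C R' \<and> A3 T0 R'}"

text \<open>Distributions on \<open>X\<close> and utilities on \<open>X\<close> are functions on the whole type, normalised to
  vanish off \<open>X\<close>, so that equality and closedness are those of the functions on \<open>X\<close>. Infinite
  sums occur only for infinite state spaces; for finite ones they are ordinary finite sums.\<close>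

definition prob_dists :: "'x set \<Rightarrow> ('x \<Rightarrow> real) set" where
  "prob_dists X = {p. (\<forall>x. 0 \<le> p x) \<and> (\<forall>x. x \<notin> X \<longrightarrow> p x = 0) \<and> (p has_sum 1) X}"

definition point_masses :: "'x set \<Rightarrow> ('x \<Rightarrow> real) set" where
  "point_masses X = (\<lambda>x. indicator {x}) ` X"

definition utilities :: "'x set \<Rightarrow> ('x \<Rightarrow> real) set" where
  "utilities X = {u. \<forall>x. x \<notin> X \<longrightarrow> u x = 0}"

text \<open>The choice interpretation compatible with \<open>\<pi>\<close> that extends \<open>\<rho>0\<close>.\<close>

primrec choice_interp ::
  "('p test \<Rightarrow> 's set) \<Rightarrow> ('c \<Rightarrow> 's \<Rightarrow> 'o \<Rightarrow> real) \<Rightarrow> ('p, 'c) choice \<Rightarrow> 's \<Rightarrow> 'o \<Rightarrow> real" where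
  "choice_interp \<pi> \<rho>0 (Basic c) s = \<rho>0 c s"
| "choice_interp \<pi> \<rho>0 (Ite t a b) s =
     (if s \<in> \<pi> t then choice_interp \<pi> \<rho>0 a s else choice_interp \<pi> \<rho>0 b s)"
| "choice_interp \<pi> \<rho>0 (Mix r a b) s =
     (\<lambda>x. r * choice_interp \<pi> \<rho>0 a s x + (1 - r) * choice_interp \<pi> \<rho>0 b s x)"

definition expected_utility ::
  "'s set \<Rightarrow> 'o set \<Rightarrow> ('s \<Rightarrow> 'o \<Rightarrow> real) \<Rightarrow> ('o \<Rightarrow> real) \<Rightarrow> ('s \<Rightarrow> real) \<Rightarrow> real" where
  "expected_utility S Out \<rho> u p = (\<Sum>\<^sub>\<infinity>(s, x)\<in>S \<times> Out. u x * \<rho> s x * p s)"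

text \<open>Finiteness of the state space \<open>S\<close> is deliberately not part of the next predicate but of
  \<open>has_SEU_representation\<close>, because the set \<open>EX_AX T0 Th C R\<close>, from which a particular state
  space is built, is in general infinite.\<close>

definition SEU_representation ::
  "'p set \<Rightarrow> 'c set \<Rightarrow> 'p test set \<Rightarrow> ('p, 'c) choice set \<Rightarrow> ('p, 'c) pref \<Rightarrow>
   's set \<Rightarrow> 'o set \<Rightarrow> ('o \<Rightarrow> real) set \<Rightarrow> ('s \<Rightarrow> real) set \<Rightarrow> (('o \<Rightarrow> real) \<times> ('s \<Rightarrow> real)) set \<Rightarrow>
   ('p test \<Rightarrow> 's set) \<Rightarrow> ('c \<Rightarrow> 's \<Rightarrow> 'o \<Rightarrow> real) \<Rightarrow> bool" where
  "SEU_representation T0 A0 Th C R S Out U P V \<pi> \<rho>0 \<longleftrightarrow>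
     finite Out \<and>
     U \<subseteq> utilities Out \<and>
     P \<subseteq> prob_dists S \<and> closed P \<and>
     V \<subseteq> U \<times> P \<and> closed V \<and>
     test_interp T0 S \<pi> \<and> respects_theory S \<pi> Th \<and>
     (\<forall>c\<in>A0. \<forall>s\<in>S. \<rho>0 c s \<in> point_masses Out) \<and>
     (\<forall>a\<in>C. \<forall>b\<in>C. (a, b) \<in> R \<longleftrightarrow>
        (\<forall>(u, p)\<in>V. expected_utility S Out (choice_interp \<pi> \<rho>0 a) u p \<ge>
                     expected_utility S Out (choice_interp \<pi> \<rho>0 b) u p))"

text \<open>States and outcomes form finite sets of arbitrary objects; up to renaming these are finite
  sets of natural numbers.\<close>

definition has_SEU_representation ::
  "'p set \<Rightarrow> 'c set \<Rightarrow> 'p test set \<Rightarrow> ('p, 'c) choice set \<Rightarrow> ('p, 'c) pref \<Rightarrow> bool" where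
  "has_SEU_representation T0 A0 Th C R \<longleftrightarrow>
     (\<exists>(S::nat set) (Out::nat set) U P V \<pi> \<rho>0.
        finite S \<and> SEU_representation T0 A0 Th C R S Out U P V \<pi> \<rho>0)"

end

theory Submission
  imports Defs "HOL-Analysis.Analysis"
begin

text \<open>Up to indifference a choice is its vector over the consistent atoms and the primitive
  choices, and an expected utility is a linear functional of this vector. By \<open>A2_dagger\<close> and
  \<open>A3\<close>, whether \<open>a\<close> is preferred to \<open>b\<close> depends only on the direction of the difference of their
  vectors, and the directions of preference form a convex cone. A difference that is not a
  preference has positive distance from the cone: all small vectors of the linear span are small
  multiples of differences of choices, so a preferred direction close to \<open>a - b\<close> is realised by
  slight perturbations of \<open>a\<close> and \<open>b\<close>, and closedness applies. Hence functionals that respect the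
  preference separate it from every non-preference. A functional is turned into a utility (states
  are atoms with uniform probability, outcomes are pairs of an atom and a primitive choice) or,
  after adding a constant and normalising, into a probability (states are bets on primitive
  choices).\<close>

subsection \<open>Separation from a convex cone\<close>

text \<open>The axiom \<open>A3\<close> closes the graph only under limits of pairs of choices.
  Vectors of the cone that tend to \<open>a - b\<close>, however, are multiples
  \<open>s (x - y)\<close> whose factors may be unbounded while \<open>x - y\<close> shrinks to
  zero, so that the pairs \<open>(x, y)\<close> say nothing in the limit. Every limit is therefore
  moved to a fixed pair: only mixtures with weights tending to 1 are passed to the limit, both here
  and where a real factor is approximated by rational ones. The choices may span only a thin part of
  the ambient space, so no ball around a choice is available; the domination of a seminorm on the
  span of the differences takes its place. Cancellation by itself, being a statement about finite
  sequences, yields rational factors only. A functional may be shifted by a constant because the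
  coordinates of a choice sum to 1 on every atom.\<close>

lemma nonneg_of_small_perturbations:
  fixes A B :: real
  assumes "\<And>s. 0 < s \<Longrightarrow> s \<le> 1 \<Longrightarrow> 0 \<le> 2 * s * A + s\<^sup>2 * B"
  shows "0 \<le> A"
proof (rule ccontr)
  assume "\<not> 0 \<le> A"
  \<comment> \<open>Division of the hypothesis by \<open>s\<close> leaves
    \<open>0 \<le> 2 * A + s * B\<close>. For this \<open>s\<close>, the term \<open>s * B\<close>
    is at most \<open>- A\<close>, so the right-hand side is at most \<open>A\<close>, which is
    negative.\<close>
  define s where "s = min 1 (- A / (\<bar>B\<bar> + 1))"
  have s: "0 < s" "s \<le> 1" using \<open>\<not> 0 \<le> A\<close> by (auto simp: s_def divide_neg_pos)
  have "s \<le> - A / (\<bar>B\<bar> + 1)" by (simp add: s_def)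
  then have "s * (\<bar>B\<bar> + 1) \<le> - A" by (subst (asm) pos_le_divide_eq) auto
  moreover have "s * B \<le> s * (\<bar>B\<bar> + 1)" using s by (intro mult_left_mono) auto
  moreover have "0 \<le> s * (2 * A + s * B)"
    using assms[OF s] by (simp add: algebra_simps power2_eq_square)
  then have "0 \<le> 2 * A + s * B" using s by (simp add: zero_le_mult_iff)
  ultimately show False using \<open>\<not> 0 \<le> A\<close> by linarith
qed

text \<open>The functional is the difference \<open>l - z\<close> between \<open>z\<close> and its projection \<open>l\<close> on the closure
  of the cone.\<close>

lemma cone_separation:
  fixes D :: "('i \<Rightarrow> real) set" and z :: "'i \<Rightarrow> real"
  assumes "finite I" and "D \<noteq> {}"
    and scale: "\<And>d s. d \<in> D \<Longrightarrow> 0 \<le> s \<Longrightarrow> (\<lambda>i. s * d i) \<in> D"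
    and add: "\<And>d d'. d \<in> D \<Longrightarrow> d' \<in> D \<Longrightarrow> (\<lambda>i. d i + d' i) \<in> D"
    and "0 < \<epsilon>" and far: "\<And>d. d \<in> D \<Longrightarrow> \<epsilon> \<le> (\<Sum>i\<in>I. (z i - d i)\<^sup>2)"
  obtains f where "\<And>d. d \<in> D \<Longrightarrow> 0 \<le> (\<Sum>i\<in>I. f i * d i)" and "(\<Sum>i\<in>I. f i * z i) < 0"
proof -
  define Q where "Q = (\<lambda>d. \<Sum>i\<in>I. (z i - d i)\<^sup>2)"
  define q where "q = (INF d\<in>D. Q d)"
  have bdd: "bdd_below (Q ` D)" using far by (intro bdd_belowI2[of _ \<epsilon>]) (auto simp: Q_def)
  have q_le: "q \<le> Q d" if "d \<in> D" for d using bdd that by (auto simp: q_def intro: cINF_lower)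
  have "\<epsilon> \<le> q" unfolding q_def using \<open>D \<noteq> {}\<close> far by (intro cINF_greatest) (auto simp: Q_def)
  then have "0 < q" using \<open>0 < \<epsilon>\<close> by simp
  have "\<exists>d\<in>D. Q d < q + 1 / (real n + 1)" for n
  proof (rule ccontr)
    assume "\<not> ?thesis"
    then have "q + 1 / (real n + 1) \<le> q"
      unfolding q_def[symmetric] using \<open>D \<noteq> {}\<close>
      by (subst (2) q_def, intro cINF_greatest) (auto simp: not_less)
    moreover have "1 / (real n + 1) > 0" by simp
    ultimately show False by linarith
  qed
  then obtain e where e: "\<And>n. e n \<in> D" "\<And>n. Q (e n) < q + 1 / (real n + 1)" by metis
  have "bounded ((\<lambda>d. d i) ` range e)" if "i \<in> I" for i
  proof -
    have "\<bar>e n i\<bar> \<le> \<bar>z i\<bar> + (q + 1)" for n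
    proof -
      have "(z i - e n i)\<^sup>2 \<le> Q (e n)"
        unfolding Q_def using that \<open>finite I\<close> by (intro member_le_sum) auto
      also have "\<dots> \<le> q + 1"
        using e(2)[of n] by (smt (verit) divide_le_eq_1 of_nat_0_le_iff)
      finally have sq: "(z i - e n i)\<^sup>2 \<le> q + 1" .
      \<comment> \<open>As \<open>q + 1\<close> is at least 1, it is dominated by its own square,
        which gives a bound without a root.\<close>
      have "\<bar>z i - e n i\<bar> \<le> q + 1"
      proof (rule power2_le_imp_le)
        have "(q + 1) * 1 \<le> (q + 1) * (q + 1)" using \<open>0 < q\<close> by (intro mult_left_mono) auto
        then show "\<bar>z i - e n i\<bar>\<^sup>2 \<le> (q + 1)\<^sup>2" using sq by (simp add: power2_eq_square)
      qed (use \<open>0 < q\<close> in auto)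
      then show ?thesis by linarith
    qed
    then show ?thesis by (intro boundedI[of _ "\<bar>z i\<bar> + (q + 1)"]) auto
  qed
  then obtain l r where r: "strict_mono r"
    and l: "\<And>\<epsilon>. 0 < \<epsilon> \<Longrightarrow> \<forall>\<^sub>F n in sequentially. \<forall>i\<in>I. dist (e (r n) i) (l i) < \<epsilon>"
    using compact_lemma_general[OF \<open>finite I\<close>, of "\<lambda>d i. d i" e "\<lambda>d. d"] by blast
  have lim: "(\<lambda>n. e (r n) i) \<longlonglongrightarrow> l i" if "i \<in> I" for i
    unfolding tendsto_iff
  proof (intro allI impI)
    fix \<epsilon> :: real assume "0 < \<epsilon>"
    from l[OF this] show "\<forall>\<^sub>F n in sequentially. dist (e (r n) i) (l i) < \<epsilon>"
      by (rule eventually_mono) (use that in auto)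
  qed
  have Q_lim: "(\<lambda>n. Q (\<lambda>i. t * e (r n) i + w i)) \<longlonglongrightarrow> Q (\<lambda>i. t * l i + w i)" for t w
    unfolding Q_def by (intro tendsto_intros lim)
  have "Q l \<le> q"
  proof (rule LIMSEQ_le)
    show "(\<lambda>n. Q (e (r n))) \<longlonglongrightarrow> Q l" using Q_lim[of 1 "\<lambda>_. 0"] by simp
    have "(\<lambda>n. q + 1 / (real n + 1)) \<longlonglongrightarrow> q + 0"
      by (intro tendsto_intros) (use lim_inverse_n' LIMSEQ_inverse_real_of_nat in \<open>simp add: inverse_eq_divide add.commute\<close>)
    from LIMSEQ_subseq_LIMSEQ[OF this r] show "(\<lambda>n. q + 1 / (real (r n) + 1)) \<longlonglongrightarrow> q"
      by (simp add: o_def)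
    show "\<exists>N. \<forall>n\<ge>N. Q (e (r n)) \<le> q + 1 / (real (r n) + 1)"
      using e(2) by (auto intro: less_imp_le)
  qed
  \<comment> \<open>The limit \<open>l\<close> need not belong to \<open>D\<close>. Its nonnegative
    multiples, shifted by members of \<open>D\<close>, are still limits of members of
    \<open>D\<close> on the coordinates in \<open>I\<close>, so \<open>q\<close> bounds their
    distance as well.\<close>
  have ge: "q \<le> Q (\<lambda>i. t * l i + w i)" if "0 \<le> t" "w \<in> D \<or> w = (\<lambda>_. 0)" for t w
  proof (rule tendsto_lowerbound[OF Q_lim])
    have "(\<lambda>i. t * e (r n) i + w i) \<in> D" for n
      using that scale[OF e(1)] add by fastforce
    then show "\<forall>\<^sub>F n in sequentially. q \<le> Q (\<lambda>i. t * e (r n) i + w i)"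
      using q_le by (intro always_eventually) auto
  qed auto
  define f where "f = (\<lambda>i. l i - z i)"
  have Q_expand: "Q (\<lambda>i. l i + s * w i)
      = Q l + (2 * s * (\<Sum>i\<in>I. f i * w i) + s\<^sup>2 * (\<Sum>i\<in>I. (w i)\<^sup>2))" for s w
    unfolding Q_def f_def sum_distrib_left sum.distrib[symmetric]
    by (intro sum.cong) (auto simp: power2_eq_square algebra_simps)
  \<comment> \<open>The first-order condition at the minimiser \<open>l\<close> in the direction
    \<open>d\<close>.\<close>
  have pos: "0 \<le> (\<Sum>i\<in>I. f i * d i)" if "d \<in> D" for d
  proof (rule nonneg_of_small_perturbations)
    fix s :: real assume "0 < s"
    then have "q \<le> Q (\<lambda>i. 1 * l i + s * d i)" using that by (intro ge disjI1 scale) auto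
    then show "0 \<le> 2 * s * (\<Sum>i\<in>I. f i * d i) + s\<^sup>2 * (\<Sum>i\<in>I. (d i)\<^sup>2)"
      using \<open>Q l \<le> q\<close> by (simp add: Q_expand)
  qed
  \<comment> \<open>The first-order condition in the direction \<open>- l\<close>: shrinking
    \<open>l\<close> by \<open>1 - s\<close> stays in the closure of the cone as long as
    \<open>s \<le> 1\<close>.\<close>
  have "0 \<le> - (\<Sum>i\<in>I. f i * l i)"
  proof (rule nonneg_of_small_perturbations)
    fix s :: real assume "0 < s" "s \<le> 1"
    then have "q \<le> Q (\<lambda>i. (1 - s) * l i + 0)" by (intro ge) auto
    also have "(\<lambda>i. (1 - s) * l i + 0) = (\<lambda>i. l i + (- s) * l i)" by (auto simp: algebra_simps)
    finally show "0 \<le> 2 * s * - (\<Sum>i\<in>I. f i * l i) + s\<^sup>2 * (\<Sum>i\<in>I. (l i)\<^sup>2)"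
      using \<open>Q l \<le> q\<close> unfolding Q_expand by simp
  qed
  \<comment> \<open>Substitute \<open>z i = l i - f i\<close>; the squared length of
    \<open>f\<close> is \<open>Q l\<close>.\<close>
  moreover have "(\<Sum>i\<in>I. f i * z i) = (\<Sum>i\<in>I. f i * l i) - Q l"
    unfolding Q_def f_def sum_subtractf[symmetric]
    by (intro sum.cong) (auto simp: power2_eq_square algebra_simps)
  moreover have "0 < Q l" using ge[of 1 "\<lambda>_. 0"] \<open>0 < q\<close> by simp
  ultimately have "(\<Sum>i\<in>I. f i * z i) < 0" by linarith
  with pos that show ?thesis by blast
qed

text \<open>\<open>G e t\<close> bounds a seminorm of \<open>e\<close> by \<open>t\<close>: on a finite-dimensional space every seminorm is
  dominated by the \<open>\<ell>\<^sup>1\<close>-norm. The induction eliminates one coordinate at a time.\<close>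

lemma finite_dimensional_bound:
  fixes W :: "('i \<Rightarrow> real) set" and G :: "('i \<Rightarrow> real) \<Rightarrow> real \<Rightarrow> bool"
  assumes "finite I"
    and "\<And>e s. e \<in> W \<Longrightarrow> (\<lambda>i. s * e i) \<in> W"
    and "\<And>e e'. e \<in> W \<Longrightarrow> e' \<in> W \<Longrightarrow> (\<lambda>i. e i + e' i) \<in> W"
    and "\<And>e. e \<in> W \<Longrightarrow> \<exists>t. G e t"
    and G_zero: "\<And>e. e \<in> W \<Longrightarrow> (\<forall>i\<in>I. e i = 0) \<Longrightarrow> G e 0"
    and G_scale: "\<And>e t s. e \<in> W \<Longrightarrow> G e t \<Longrightarrow> G (\<lambda>i. s * e i) (\<bar>s\<bar> * t)"
    and G_add: "\<And>e t e' t'. e \<in> W \<Longrightarrow> e' \<in> W \<Longrightarrow> G e t \<Longrightarrow> G e' t' \<Longrightarrow> G (\<lambda>i. e i + e' i) (t + t')"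
  shows "\<exists>M\<ge>0. \<forall>e\<in>W. \<exists>t. G e t \<and> t \<le> M * (\<Sum>i\<in>I. \<bar>e i\<bar>)"
  using assms
proof (induction I arbitrary: W rule: finite_induct)
  case empty
  then show ?case by (intro exI[of _ 0]) force
next
  case (insert i I)
  note scale = insert.prems(1) and add = insert.prems(2) and ex = insert.prems(3)
    and zero = insert.prems(4) and Gs = insert.prems(5) and Ga = insert.prems(6)
  define W' where "W' = {e\<in>W. e i = 0}"
  have "\<exists>M\<ge>0. \<forall>e\<in>W'. \<exists>t. G e t \<and> t \<le> M * (\<Sum>j\<in>I. \<bar>e j\<bar>)"
  proof (rule insert.IH)
    fix e s assume "e \<in> W'" then show "(\<lambda>i. s * e i) \<in> W'" using scale by (auto simp: W'_def)
  next
    fix e e' assume "e \<in> W'" "e' \<in> W'"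
    then show "(\<lambda>i. e i + e' i) \<in> W'" using add by (auto simp: W'_def)
  qed (use ex zero Gs Ga in \<open>auto simp: W'_def\<close>)
  then obtain M where M: "0 \<le> M" "\<And>e. e \<in> W' \<Longrightarrow> \<exists>t. G e t \<and> t \<le> M * (\<Sum>j\<in>I. \<bar>e j\<bar>)" by blast
  show ?case
  proof (cases "W' = W")
    case True
    have "\<exists>t. G e t \<and> t \<le> M * (\<Sum>j\<in>insert i I. \<bar>e j\<bar>)" if "e \<in> W" for e
    proof -
      from that True have "e \<in> W'" by simp
      moreover from this have "e i = 0" by (simp add: W'_def)
      ultimately show ?thesis using M(2)[of e] insert.hyps by auto
    qed
    then show ?thesis using M(1) by blast
  next
    case False
    then obtain b' where b': "b' \<in> W" "b' i \<noteq> 0" by (auto simp: W'_def)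
    \<comment> \<open>Normalised to \<open>b i = 1\<close>, so that subtracting \<open>e i\<close>
      times \<open>b\<close> from \<open>e\<close> lands in \<open>W'\<close>, where the induction
      hypothesis applies.\<close>
    define b where "b = (\<lambda>j. inverse (b' i) * b' j)"
    have b: "b \<in> W" "b i = 1" using b' scale by (auto simp: b_def)
    obtain u where u: "G b u" using ex[OF b(1)] by blast
    define B where "B = (\<Sum>j\<in>I. \<bar>b j\<bar>)"
    \<comment> \<open>Large enough for both coefficients that arise: \<open>M\<close> for the
      coordinates in \<open>I\<close>, and \<open>M * B + \<bar>u\<bar>\<close> for the multiple of
      \<open>b\<close> that is split off.\<close>
    define N where "N = M + \<bar>u\<bar> + M * B"
    have "0 \<le> B" by (simp add: B_def sum_nonneg)
    have "0 \<le> N" using M(1) \<open>0 \<le> B\<close> by (simp add: N_def)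
    have "\<exists>t. G e t \<and> t \<le> N * (\<Sum>j\<in>insert i I. \<bar>e j\<bar>)" if e: "e \<in> W" for e
    proof -
      define e' where "e' = (\<lambda>j. e j + (- e i) * b j)"
      have "e' \<in> W'" using add[OF e scale[OF b(1), of "- e i"]] b(2) by (simp add: W'_def e'_def)
      then obtain t where t: "G e' t" "t \<le> M * (\<Sum>j\<in>I. \<bar>e' j\<bar>)" using M(2) by blast
      have "G (\<lambda>j. e' j + e i * b j) (t + \<bar>e i\<bar> * u)"
        using \<open>e' \<in> W'\<close> scale[OF b(1)] t(1) Gs[OF b(1) u] by (intro Ga) (auto simp: W'_def)
      moreover have "(\<lambda>j. e' j + e i * b j) = e" by (simp add: e'_def)
      ultimately have G: "G e (t + \<bar>e i\<bar> * u)" by simp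
      have "(\<Sum>j\<in>I. \<bar>e' j\<bar>) \<le> (\<Sum>j\<in>I. \<bar>e j\<bar> + \<bar>e i\<bar> * \<bar>b j\<bar>)"
        by (intro sum_mono) (simp add: e'_def abs_mult[symmetric])
      also have "\<dots> = (\<Sum>j\<in>I. \<bar>e j\<bar>) + \<bar>e i\<bar> * B" by (simp add: sum.distrib B_def sum_distrib_left)
      finally have "M * (\<Sum>j\<in>I. \<bar>e' j\<bar>) \<le> M * ((\<Sum>j\<in>I. \<bar>e j\<bar>) + \<bar>e i\<bar> * B)"
        using M(1) by (rule mult_left_mono)
      moreover have "\<bar>e i\<bar> * u \<le> \<bar>e i\<bar> * \<bar>u\<bar>" by (intro mult_left_mono) auto
      ultimately have "t + \<bar>e i\<bar> * u \<le> M * (\<Sum>j\<in>I. \<bar>e j\<bar>) + (M * B + \<bar>u\<bar>) * \<bar>e i\<bar>"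
        using t(2) by (simp add: algebra_simps)
      also have "\<dots> \<le> N * (\<Sum>j\<in>I. \<bar>e j\<bar>) + N * \<bar>e i\<bar>"
        using M(1) \<open>0 \<le> B\<close> by (intro add_mono mult_right_mono) (auto simp: N_def sum_nonneg)
      also have "\<dots> = N * (\<Sum>j\<in>insert i I. \<bar>e j\<bar>)" using insert.hyps by (simp add: algebra_simps)
      finally show ?thesis using G by blast
    qed
    then show ?thesis using \<open>0 \<le> N\<close> by blast
  qed
qed

subsection \<open>Cancellative preferences on a mixture space\<close>

text \<open>The axioms enter only in this form: \<open>cancellation\<close> looks at finitely many
  coordinates, and \<open>limit\<close> is closedness restricted to mixtures that tend to a fixed
  pair. \<open>F\<close> may identify elements; those with equal coordinates are indifferent by
  cancellation.\<close>

locale cancellative_preference =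
  fixes X :: "'x set" and I :: "'i set" and F :: "'x \<Rightarrow> 'i \<Rightarrow> real"
    and mix :: "real \<Rightarrow> 'x \<Rightarrow> 'x \<Rightarrow> 'x" and R :: "('x \<times> 'x) set"
  assumes finite_I: "finite I"
    and R_subset: "R \<subseteq> X \<times> X"
    and mix_closed: "\<And>r x y. 0 \<le> r \<Longrightarrow> r \<le> 1 \<Longrightarrow> x \<in> X \<Longrightarrow> y \<in> X \<Longrightarrow> mix r x y \<in> X"
    and F_mix: "\<And>r x y i. i \<in> I \<Longrightarrow> F (mix r x y) i = r * F x i + (1 - r) * F y i"
    and cancellation: "\<And>(n::nat) (k::nat) a b. k < n \<Longrightarrow>
        (\<And>j. j \<in> {1..n} \<Longrightarrow> a j \<in> X \<and> b j \<in> X) \<Longrightarrow>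
        (\<And>i. i \<in> I \<Longrightarrow> (\<Sum>j=1..n. F (a j) i) = (\<Sum>j=1..n. F (b j) i)) \<Longrightarrow>
        (\<And>j. j \<in> {1..k} \<Longrightarrow> (a j, b j) \<in> R) \<Longrightarrow>
        (\<And>j. j \<in> {k+1..n} \<Longrightarrow> a j = a n \<and> b j = b n) \<Longrightarrow> (b n, a n) \<in> R"
    and limit: "\<And>r x y x' y'. x \<in> X \<Longrightarrow> y \<in> X \<Longrightarrow> (\<And>n::nat. x' n \<in> X) \<Longrightarrow> (\<And>n. y' n \<in> X) \<Longrightarrow>
        (\<And>n. 0 \<le> r n \<and> r n \<le> 1) \<Longrightarrow> r \<longlonglongrightarrow> 1 \<Longrightarrow>
        (\<And>n. (mix (r n) x (x' n), mix (r n) y (y' n)) \<in> R) \<Longrightarrow> (x, y) \<in> R"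
begin

text \<open>Cancellation with \<open>m\<close> copies of \<open>(x, y)\<close> followed by
  \<open>n\<close> copies of \<open>(y', x')\<close>: the assumption \<open>eq\<close> says that
  both columns have the same sum, and the conclusion reverses the repeated last pair. The case
  \<open>m = 0\<close> covers pairs with equal coordinates.\<close>

lemma rational_multiple:
  fixes m n :: nat
  assumes "(x, y) \<in> R" "x' \<in> X" "y' \<in> X" "0 < n"
    and eq: "\<And>i. i \<in> I \<Longrightarrow> real n * (F x' i - F y' i) = real m * (F x i - F y i)"
  shows "(x', y') \<in> R"
proof -
  have xy: "x \<in> X" "y \<in> X" using assms(1) R_subset by auto
  define a where "a = (\<lambda>j. if j \<le> m then x else y')"
  define b where "b = (\<lambda>j. if j \<le> m then y else x')"
  have sum: "(\<Sum>j=1..m + n. if j \<le> m then u else v) = real m * u + real n * v" for u v :: real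
  proof -
    have "{1..m + n} \<inter> {j. j \<le> m} = {1..m}" "{1..m + n} \<inter> - {j. j \<le> m} = {m+1..m + n}" by auto
    then show ?thesis by (simp add: sum.If_cases)
  qed
  have "(b (m + n), a (m + n)) \<in> R"
  proof (rule cancellation)
    show "m < m + n" using assms(4) by simp
    show "a j \<in> X \<and> b j \<in> X" for j using xy assms(2,3) by (auto simp: a_def b_def)
    show "(a j, b j) \<in> R" if "j \<in> {1..m}" for j using that assms(1) by (auto simp: a_def b_def)
    show "a j = a (m + n) \<and> b j = b (m + n)" if "j \<in> {m+1..m+n}" for j
      using that by (auto simp: a_def b_def)
    show "(\<Sum>j=1..m + n. F (a j) i) = (\<Sum>j=1..m + n. F (b j) i)" if "i \<in> I" for i
    proof -
      have "(\<Sum>j=1..m + n. F (a j) i) = real m * F x i + real n * F y' i"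
        unfolding a_def sum[symmetric] by (intro sum.cong) auto
      moreover have "(\<Sum>j=1..m + n. F (b j) i) = real m * F y i + real n * F x' i"
        unfolding b_def sum[symmetric] by (intro sum.cong) auto
      ultimately show ?thesis using eq[OF that] by (simp add: algebra_simps)
    qed
  qed
  then show ?thesis using assms(4) by (simp add: a_def b_def)
qed

text \<open>The third pair \<open>(v, u)\<close> balances the two preferences, and cancellation
  reverses it.\<close>

lemma sum_of_differences:
  assumes "(x, y) \<in> R" "(x', y') \<in> R" "u \<in> X" "v \<in> X"
    and eq: "\<And>i. i \<in> I \<Longrightarrow> F u i - F v i = (F x i - F y i) + (F x' i - F y' i)"
  shows "(u, v) \<in> R"
proof -
  define a where "a = (\<lambda>j::nat. if j = 1 then x else if j = 2 then x' else v)"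
  define b where "b = (\<lambda>j::nat. if j = 1 then y else if j = 2 then y' else u)"
  have "(b 3, a 3) \<in> R"
  proof (rule cancellation[of 2])
    show "a j \<in> X \<and> b j \<in> X" for j using assms R_subset by (auto simp: a_def b_def)
    show "(a j, b j) \<in> R" if "j \<in> {1..2}" for j
      using that assms by (auto simp: a_def b_def le_Suc_eq numeral_2_eq_2)
    show "a j = a 3 \<and> b j = b 3" if "j \<in> {2+1..3}" for j using that by auto
    show "(\<Sum>j=1..3. F (a j) i) = (\<Sum>j=1..3. F (b j) i)" if "i \<in> I" for i
      using eq[OF that] by (simp add: a_def b_def numeral_3_eq_3 numeral_2_eq_2)
  qed auto
  then show ?thesis by (simp add: a_def b_def)
qed

text \<open>Mixing \<open>y'\<close> into both members shrinks the difference of \<open>x'\<close>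
  and \<open>y'\<close> by a factor \<open>r n\<close>, chosen so that \<open>r n * s\<close> is
  rational when \<open>r n\<close> tends to 1. The rational case yields preferences between the
  mixtures, and \<open>limit\<close> removes the admixture.\<close>

lemma real_multiple:
  assumes "(x, y) \<in> R" "x' \<in> X" "y' \<in> X" "0 \<le> s"
    and eq: "\<And>i. i \<in> I \<Longrightarrow> F x' i - F y' i = s * (F x i - F y i)"
  shows "(x', y') \<in> R"
proof (cases "s = 0")
  case True
  then show ?thesis using rational_multiple[OF assms(1-3), of 1 0] eq by simp
next
  case False
  with assms(4) have "0 < s" by simp
  \<comment> \<open>Rounding down keeps \<open>r n\<close> at most 1, as a mixture weight must be,
    and turns \<open>r n * s\<close> into \<open>k n\<close> divided by
    \<open>Suc n\<close>.\<close>
  define k where "k = (\<lambda>n. nat \<lfloor>real (Suc n) * s\<rfloor>)"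
  define r where "r = (\<lambda>n. real (k n) / (real (Suc n) * s))"
  have k_le: "real (k n) \<le> real (Suc n) * s" for n
    unfolding k_def using \<open>0 < s\<close> by (subst of_nat_nat) auto
  have k_gt: "real (Suc n) * s - 1 < real (k n)" for n
  proof -
    have "0 \<le> real (Suc n) * s" using \<open>0 < s\<close> by simp
    then show ?thesis unfolding k_def by linarith
  qed
  have r: "0 \<le> r n" "r n \<le> 1" for n
    using k_le[of n] \<open>0 < s\<close> by (auto simp: r_def divide_le_eq)
  have lim: "r \<longlonglongrightarrow> 1"
  proof (rule tendsto_sandwich)
    show "\<forall>\<^sub>F n in sequentially. 1 - inverse (real (Suc n)) * inverse s \<le> r n"
    proof (intro always_eventually allI)
      fix n
      have "1 - inverse (real (Suc n)) * inverse s = (real (Suc n) * s - 1) / (real (Suc n) * s)"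
        using \<open>0 < s\<close> by (simp add: field_simps del: of_nat_Suc)
      also have "\<dots> \<le> r n"
        unfolding r_def using k_gt[of n] \<open>0 < s\<close> by (intro divide_right_mono) auto
      finally show "1 - inverse (real (Suc n)) * inverse s \<le> r n" .
    qed
    have "(\<lambda>n. 1 - inverse (real (Suc n)) * inverse s) \<longlonglongrightarrow> 1 - 0 * inverse s"
      by (intro tendsto_intros LIMSEQ_inverse_real_of_nat)
    then show "(\<lambda>n. 1 - inverse (real (Suc n)) * inverse s) \<longlonglongrightarrow> 1" by simp
    show "\<forall>\<^sub>F n in sequentially. r n \<le> 1" using r(2) by simp
  qed auto
  show ?thesis
  proof (rule limit[OF assms(2,3), of "\<lambda>_. y'" "\<lambda>_. y'"])
    fix n
    have "r n * s = real (k n) / real (Suc n)" using \<open>0 < s\<close> by (simp add: r_def)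
    then have rs: "real (Suc n) * (r n * s) = real (k n)" by (simp del: of_nat_Suc)
    show "(mix (r n) x' y', mix (r n) y' y') \<in> R"
    proof (rule rational_multiple[OF assms(1), where n = "Suc n" and m = "k n"])
      fix i assume i: "i \<in> I"
      have "F (mix (r n) x' y') i - F (mix (r n) y' y') i = r n * (F x' i - F y' i)"
        using i by (simp add: F_mix algebra_simps)
      also have "\<dots> = (r n * s) * (F x i - F y i)" by (simp add: eq[OF i])
      finally show "real (Suc n) * (F (mix (r n) x' y') i - F (mix (r n) y' y') i)
          = real (k n) * (F x i - F y i)"
        by (simp only: rs[symmetric] mult.assoc)
    qed (use r assms mix_closed in auto)
  qed (use assms r lim in auto)
qed

section \<open>The convex cone of preferred directions\<close>

definition cone :: "('i \<Rightarrow> real) set" where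
  "cone = {d. \<exists>s x y. 0 \<le> s \<and> (x, y) \<in> R \<and> (\<forall>i\<in>I. d i = s * (F x i - F y i))}"

lemma preferred_refl:
  assumes "x \<in> X"
  shows "(x, x) \<in> R"
  using cancellation[of 0 1 "\<lambda>_. x" "\<lambda>_. x"] assms by auto

lemma preferred_iff_cone:
  assumes "x \<in> X" "y \<in> X"
  shows "(x, y) \<in> R \<longleftrightarrow> (\<lambda>i. F x i - F y i) \<in> cone"
proof
  show "(\<lambda>i. F x i - F y i) \<in> cone" if "(x, y) \<in> R"
    using that unfolding cone_def by (intro CollectI exI[of _ 1] exI[of _ x] exI[of _ y]) auto
qed (use real_multiple assms in \<open>auto simp: cone_def\<close>)

lemma cone_scale:
  assumes "d \<in> cone" "0 \<le> s"
  shows "(\<lambda>i. s * d i) \<in> cone"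
proof -
  obtain s' x y where "0 \<le> s'" "(x, y) \<in> R" "\<forall>i\<in>I. d i = s' * (F x i - F y i)"
    using assms(1) by (auto simp: cone_def)
  then show ?thesis using assms(2)
    unfolding cone_def by (intro CollectI exI[of _ "s * s'"] exI[of _ x] exI[of _ y]) auto
qed

text \<open>The factors are normalised to the weight \<open>s / (s + s')\<close>, which mixes the
  left and the right members alike. Sums of multiples of differences are thus multiples of
  differences, for preferences as well as for arbitrary pairs.\<close>

lemma convex_combination:
  assumes "0 \<le> s" "0 \<le> s'" "x \<in> X" "y \<in> X" "x' \<in> X" "y' \<in> X"
  shows "\<exists>r. 0 \<le> r \<and> r \<le> 1 \<and> (\<forall>i\<in>I. s * (F x i - F y i) + s' * (F x' i - F y' i) =
    (s + s') * (F (mix r x x') i - F (mix r y y') i))"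
proof (cases "s + s' = 0")
  case True
  then have "s = 0" "s' = 0" using assms by auto
  then show ?thesis by (intro exI[of _ 0]) auto
next
  case False
  define r where "r = s / (s + s')"
  have r: "(s + s') * r = s" "(s + s') * (1 - r) = s'" using False by (auto simp: r_def field_simps)
  show ?thesis
  proof (intro exI[of _ r] conjI ballI)
    fix i assume "i \<in> I"
    then have "(s + s') * (F (mix r x x') i - F (mix r y y') i)
        = ((s + s') * r) * (F x i - F y i) + ((s + s') * (1 - r)) * (F x' i - F y' i)"
      by (simp add: F_mix algebra_simps)
    then show "s * (F x i - F y i) + s' * (F x' i - F y' i)
        = (s + s') * (F (mix r x x') i - F (mix r y y') i)"
      unfolding r by simp
  qed (use assms False in \<open>auto simp: r_def field_simps\<close>)
qed

lemma cone_add: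
  assumes "d \<in> cone" "d' \<in> cone"
  shows "(\<lambda>i. d i + d' i) \<in> cone"
proof -
  obtain s x y where 1: "0 \<le> s" "(x, y) \<in> R" "\<forall>i\<in>I. d i = s * (F x i - F y i)"
    using assms(1) by (auto simp: cone_def)
  obtain s' x' y' where 2: "0 \<le> s'" "(x', y') \<in> R" "\<forall>i\<in>I. d' i = s' * (F x' i - F y' i)"
    using assms(2) by (auto simp: cone_def)
  have X: "x \<in> X" "y \<in> X" "x' \<in> X" "y' \<in> X" using 1 2 R_subset by auto
  obtain r where r: "0 \<le> r" "r \<le> 1" "\<forall>i\<in>I. s * (F x i - F y i) + s' * (F x' i - F y' i) =
      (s + s') * (F (mix r x x') i - F (mix r y y') i)"
    using convex_combination[OF 1(1) 2(1) X] by blast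
  \<comment> \<open>The vectors of \<open>mix r x x'\<close> and \<open>mix r y y'\<close> differ by
    \<open>r (x - y) + (1 - r) (x' - y')\<close>; each summand is realised as a preference of its
    own, and the two are added.\<close>
  have "(mix r x y, y) \<in> R"
    by (rule real_multiple[OF 1(2), of _ _ r]) (use r X mix_closed in \<open>auto simp: F_mix algebra_simps\<close>)
  moreover have "(mix (1 - r) x' y', y') \<in> R"
    by (rule real_multiple[OF 2(2), of _ _ "1 - r"])
      (use r X mix_closed in \<open>auto simp: F_mix algebra_simps\<close>)
  ultimately have "(mix r x x', mix r y y') \<in> R"
    by (rule sum_of_differences) (use r X mix_closed in \<open>auto simp: F_mix algebra_simps\<close>)
  then show ?thesis using 1 2 r(3) unfolding cone_def
    by (intro CollectI exI[of _ "s + s'"] exI[of _ "mix r x x'"] exI[of _ "mix r y y'"]) auto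
qed

text \<open>The infimum of the admissible \<open>t\<close> is the gauge of the symmetric convex set
  of differences, a seminorm on its span. The relation is used instead because it keeps a pair that
  realises the factor.\<close>

definition difference_of :: "('i \<Rightarrow> real) \<Rightarrow> real \<Rightarrow> bool" where
  "difference_of e t \<longleftrightarrow>
     0 \<le> t \<and> (\<exists>x\<in>X. \<exists>y\<in>X. \<forall>i\<in>I. e i = t * (F x i - F y i))"

lemma difference_of_scale:
  assumes "difference_of e t"
  shows "difference_of (\<lambda>i. s * e i) (\<bar>s\<bar> * t)"
proof -
  obtain x y where xy: "0 \<le> t" "x \<in> X" "y \<in> X" "\<forall>i\<in>I. e i = t * (F x i - F y i)"
    using assms by (auto simp: difference_of_def)
  show ?thesis
  proof (cases "0 \<le> s")
    case True
    then show ?thesis using xy by (auto simp: difference_of_def)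
  next
    case False
    have "\<forall>i\<in>I. s * e i = (\<bar>s\<bar> * t) * (F y i - F x i)"
    proof
      fix i assume "i \<in> I"
      then have "s * e i = s * (t * (F x i - F y i))" using xy by simp
      then show "s * e i = (\<bar>s\<bar> * t) * (F y i - F x i)" using False by (simp add: algebra_simps)
    qed
    then show ?thesis using xy unfolding difference_of_def
      by (intro conjI bexI[of _ y] bexI[of _ x]) auto
  qed
qed

lemma difference_of_add:
  assumes "difference_of e t" "difference_of e' t'"
  shows "difference_of (\<lambda>i. e i + e' i) (t + t')"
proof -
  obtain x y where 1: "0 \<le> t" "x \<in> X" "y \<in> X" "\<forall>i\<in>I. e i = t * (F x i - F y i)"
    using assms(1) by (auto simp: difference_of_def)
  obtain x' y' where 2: "0 \<le> t'" "x' \<in> X" "y' \<in> X" "\<forall>i\<in>I. e' i = t' * (F x' i - F y' i)"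
    using assms(2) by (auto simp: difference_of_def)
  obtain r where "0 \<le> r" "r \<le> 1" "\<forall>i\<in>I. t * (F x i - F y i) + t' * (F x' i - F y' i) =
      (t + t') * (F (mix r x x') i - F (mix r y y') i)"
    using convex_combination[OF 1(1) 2(1) 1(2,3) 2(2,3)] by blast
  then show ?thesis using 1 2 mix_closed unfolding difference_of_def
    by (intro conjI bexI[of _ "mix r x x'"] bexI[of _ "mix r y y'"]) auto
qed

text \<open>The domination of seminorms applied to the gauge: small vectors in the span of the
  differences are small multiples of differences.\<close>

lemma difference_bound:
  shows "\<exists>M\<ge>0. \<forall>e. (\<exists>t. difference_of e t) \<longrightarrow>
    (\<exists>t. difference_of e t \<and> t \<le> M * (\<Sum>i\<in>I. \<bar>e i\<bar>))"
proof -
  have "\<exists>M\<ge>0. \<forall>e\<in>{e. \<exists>t. difference_of e t}.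
      \<exists>t. difference_of e t \<and> t \<le> M * (\<Sum>i\<in>I. \<bar>e i\<bar>)"
    by (rule finite_dimensional_bound[OF finite_I])
      (auto intro: difference_of_scale difference_of_add, auto simp: difference_of_def)
  then show ?thesis by blast
qed

text \<open>If \<open>s (x' - y')\<close> in the cone differs from \<open>x - y\<close> by the small difference \<open>t (p - q)\<close>, then
  mixing a little of \<open>q\<close> and \<open>p\<close> into \<open>x\<close> and \<open>y\<close> produces a preference with the same
  direction as \<open>x' - y'\<close>.\<close>

lemma cone_away_from_difference:
  assumes "x \<in> X" "y \<in> X" "(x, y) \<notin> R"
  shows "\<exists>\<epsilon>>0. \<forall>d\<in>cone. \<epsilon> \<le> (\<Sum>i\<in>I. (F x i - F y i - d i)\<^sup>2)"
proof (rule ccontr)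
  assume "\<not> ?thesis"
  then have "\<forall>n::nat. \<exists>d\<in>cone. (\<Sum>i\<in>I. (F x i - F y i - d i)\<^sup>2) < inverse (real (Suc n))"
    by (meson not_le inverse_positive_iff_positive of_nat_0_less_iff zero_less_Suc)
  then obtain d where d: "\<And>n. d n \<in> cone"
    "\<And>n. (\<Sum>i\<in>I. (F x i - F y i - d n i)\<^sup>2) < inverse (real (Suc n))" by metis
  define e where "e = (\<lambda>n i. F x i - F y i - d n i)"
  have e_lim: "(\<lambda>n. \<bar>e n i\<bar>) \<longlonglongrightarrow> 0" if "i \<in> I" for i
  proof -
    have "(\<lambda>n. (e n i)\<^sup>2) \<longlonglongrightarrow> 0"
    proof (rule tendsto_sandwich[OF _ _ tendsto_const LIMSEQ_inverse_real_of_nat])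
      have "(e n i)\<^sup>2 \<le> inverse (real (Suc n))" for n
      proof -
        have "(e n i)\<^sup>2 \<le> (\<Sum>i\<in>I. (e n i)\<^sup>2)" using that finite_I by (intro member_le_sum) auto
        then show ?thesis using d(2)[of n] by (simp add: e_def)
      qed
      then show "\<forall>\<^sub>F n in sequentially. (e n i)\<^sup>2 \<le> inverse (real (Suc n))" by simp
    qed auto
    from tendsto_real_sqrt[OF this] show ?thesis by simp
  qed
  obtain M where M: "0 \<le> M" "\<And>e t. difference_of e t \<Longrightarrow>
      \<exists>t. difference_of e t \<and> t \<le> M * (\<Sum>i\<in>I. \<bar>e i\<bar>)"
    using difference_bound by blast
  \<comment> \<open>The error \<open>e n\<close> is a combination of differences, hence lies in the
    span, where the bound by \<open>M\<close> applies.\<close>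
  have "\<exists>s. difference_of (d n) s" for n
    using d(1)[of n] R_subset unfolding cone_def difference_of_def by blast
  then have "\<exists>t. difference_of (e n) t" for n
  proof -
    obtain s where "difference_of (d n) s" using \<open>\<exists>s. difference_of (d n) s\<close> by blast
    from difference_of_scale[OF this, of "-1"] have "difference_of (\<lambda>i. - d n i) s" by simp
    moreover have "difference_of (\<lambda>i. F x i - F y i) 1"
      using assms by (auto simp: difference_of_def)
    ultimately show ?thesis using difference_of_add unfolding e_def by fastforce
  qed
  then have "\<forall>n. \<exists>t. difference_of (e n) t \<and> t \<le> M * (\<Sum>i\<in>I. \<bar>e n i\<bar>)" using M(2) by blast
  then obtain t where t: "\<And>n. difference_of (e n) (t n)" "\<And>n. t n \<le> M * (\<Sum>i\<in>I. \<bar>e n i\<bar>)"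
    by metis
  have t_nonneg: "0 \<le> t n" for n using t(1) by (auto simp: difference_of_def)
  have "\<forall>n. \<exists>p q. p \<in> X \<and> q \<in> X \<and> (\<forall>i\<in>I. e n i = t n * (F p i - F q i))"
    using t(1) unfolding difference_of_def by blast
  then obtain p q where pq: "\<And>n. p n \<in> X" "\<And>n. q n \<in> X"
    "\<And>n i. i \<in> I \<Longrightarrow> e n i = t n * (F (p n) i - F (q n) i)" by metis
  have t_lim: "t \<longlonglongrightarrow> 0"
  proof (rule tendsto_sandwich[OF _ _ tendsto_const])
    have "(\<lambda>n. M * (\<Sum>i\<in>I. \<bar>e n i\<bar>)) \<longlonglongrightarrow> M * (\<Sum>i\<in>I. 0)"
      by (intro tendsto_intros e_lim)
    then show "(\<lambda>n. M * (\<Sum>i\<in>I. \<bar>e n i\<bar>)) \<longlonglongrightarrow> 0" by simp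
  qed (use t_nonneg t(2) in auto)
  \<comment> \<open>The solution of \<open>1 - r n = r n * t n\<close>. With this weight the
    admixture contributes exactly \<open>- r n * e n\<close> to the difference, and
    \<open>r n * d n\<close> remains.\<close>
  define r where "r = (\<lambda>n. 1 / (1 + t n))"
  have r: "0 \<le> r n" "r n \<le> 1" for n using t_nonneg[of n] by (auto simp: r_def)
  have rt: "1 - r n = r n * t n" for n using t_nonneg[of n] by (auto simp: r_def field_simps)
  have "r \<longlonglongrightarrow> 1 / (1 + 0)" unfolding r_def by (intro tendsto_intros t_lim) auto
  then have r_lim: "r \<longlonglongrightarrow> 1" by simp
  have "(x, y) \<in> R"
  proof (rule limit[OF assms(1,2) pq(2,1) _ r_lim])
    fix n
    obtain s u v where suv: "0 \<le> s" "(u, v) \<in> R" "\<forall>i\<in>I. d n i = s * (F u i - F v i)"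
      using d(1)[of n] by (auto simp: cone_def)
    show "(mix (r n) x (q n), mix (r n) y (p n)) \<in> R"
    proof (rule real_multiple[OF suv(2), where s = "r n * s"])
      fix i assume i: "i \<in> I"
      have "F (mix (r n) x (q n)) i - F (mix (r n) y (p n)) i
          = r n * (F x i - F y i) - (1 - r n) * (F (p n) i - F (q n) i)"
        using i by (simp add: F_mix algebra_simps)
      also have "\<dots> = r n * (F x i - F y i) - r n * e n i" by (simp add: rt pq(3)[OF i])
      also have "\<dots> = r n * d n i" by (simp add: e_def algebra_simps)
      finally show "F (mix (r n) x (q n)) i - F (mix (r n) y (p n)) i = r n * s * (F u i - F v i)"
        using suv(3) i by simp
    qed (use assms pq r suv mix_closed in auto)
  qed (use r in auto)
  with assms(3) show False by simp
qed

theorem separating_functional: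
  assumes "x \<in> X" "y \<in> X" "(x, y) \<notin> R"
  obtains f where "\<And>a b. (a, b) \<in> R \<Longrightarrow> (\<Sum>i\<in>I. f i * F b i) \<le> (\<Sum>i\<in>I. f i * F a i)"
    and "(\<Sum>i\<in>I. f i * F x i) < (\<Sum>i\<in>I. f i * F y i)"
proof -
  obtain \<epsilon> where eps: "0 < \<epsilon>" "\<And>d. d \<in> cone \<Longrightarrow> \<epsilon> \<le> (\<Sum>i\<in>I. (F x i - F y i - d i)\<^sup>2)"
    using cone_away_from_difference[OF assms] by blast
  have "cone \<noteq> {}" using preferred_iff_cone[OF assms(1,1)] preferred_refl[OF assms(1)] by blast
  then obtain f where f: "\<And>d. d \<in> cone \<Longrightarrow> 0 \<le> (\<Sum>i\<in>I. f i * d i)"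
    "(\<Sum>i\<in>I. f i * (F x i - F y i)) < 0"
    using cone_separation[OF finite_I _ cone_scale cone_add eps] by blast
  have "(\<Sum>i\<in>I. f i * F b i) \<le> (\<Sum>i\<in>I. f i * F a i)" if "(a, b) \<in> R" for a b
    using f(1)[of "\<lambda>i. F a i - F b i"] preferred_iff_cone[of a b] that R_subset
    by (auto simp: right_diff_distrib sum_subtractf)
  with f(2) that show ?thesis by (auto simp: right_diff_distrib sum_subtractf)
qed

end

subsection \<open>Tests, atoms and linear scores\<close>

text \<open>A valuation is given by the set of primitive tests that it makes true. Evaluation
  replaces the quantification over interpretations in \<open>entails\<close> and
  \<open>consistent_atoms\<close>.\<close>

primrec holds :: "'p set \<Rightarrow> 'p test \<Rightarrow> bool" where
  "holds X (Prim p) \<longleftrightarrow> p \<in> X"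
| "holds X (And t1 t2) \<longleftrightarrow> holds X t1 \<and> holds X t2"
| "holds X (Neg t) \<longleftrightarrow> \<not> holds X t"

definition atom_of :: "'p set \<Rightarrow> 'p set \<Rightarrow> 'p atom" where
  "atom_of T0 X = (\<lambda>p. if p \<in> X then Prim p else Neg (Prim p)) ` T0"

lemma atoms_eq: "atoms T0 = atom_of T0 ` Pow T0"
  by (auto simp: atoms_def atom_of_def)

lemma finite_atoms: "finite T0 \<Longrightarrow> finite (atoms T0)"
  by (simp add: atoms_eq)

lemma consistent_atoms_subset: "consistent_atoms T0 Th \<subseteq> atoms T0"
  by (auto simp: consistent_atoms_def)

lemma mem_interp_iff_holds:
  assumes "test_interp T0 S \<pi>" "s \<in> S" "t \<in> tests T0"
  shows "s \<in> \<pi> t \<longleftrightarrow> holds {p\<in>T0. s \<in> \<pi> (Prim p)} t"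
  using assms(3) by induction (use assms(1,2) in \<open>auto simp: test_interp_def\<close>)

lemma test_interp_holds: "test_interp T0 S (\<lambda>t. {s\<in>S. holds (v s) t})"
  by (auto simp: test_interp_def)

lemma mem_atom_interp_iff:
  assumes "test_interp T0 S \<pi>" "X \<subseteq> T0"
  shows "s \<in> atom_interp S \<pi> (atom_of T0 X) \<longleftrightarrow> s \<in> S \<and> {p\<in>T0. s \<in> \<pi> (Prim p)} = X"
proof -
  have "\<pi> (Neg (Prim p)) = S - \<pi> (Prim p)" if "p \<in> T0" for p
    using assms(1) that by (auto simp: test_interp_def intro: tests.intros)
  then have "(\<forall>l\<in>atom_of T0 X. s \<in> \<pi> l) \<longleftrightarrow> (\<forall>p\<in>T0. s \<in> \<pi> (Prim p) \<longleftrightarrow> p \<in> X)" if "s \<in> S"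
    unfolding atom_of_def ball_simps(9) using that by (intro ball_cong) auto
  then show ?thesis using assms(2) by (auto simp: atom_interp_def)
qed

text \<open>A state inside the atom of \<open>X\<close> induces exactly the valuation
  \<open>X\<close>, and this decides every test. For the other direction, the one-state
  interpretation with valuation \<open>X\<close> has its state in the atom.\<close>

lemma entails_iff_holds:
  assumes "X \<subseteq> T0" "t \<in> tests T0"
  shows "entails T0 (atom_of T0 X) t \<longleftrightarrow> holds X t"
proof
  assume ent: "entails T0 (atom_of T0 X) t"
  define \<pi> :: "'a test \<Rightarrow> nat set" where "\<pi> = (\<lambda>t. {s\<in>{0}. holds X t})"
  have \<pi>: "test_interp T0 {0} \<pi>" unfolding \<pi>_def by (rule test_interp_holds)
  have "0 \<in> atom_interp {0} \<pi> (atom_of T0 X)"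
    using assms(1) by (subst mem_atom_interp_iff[OF \<pi> assms(1)]) (auto simp: \<pi>_def)
  then have "0 \<in> \<pi> t" using ent \<pi> unfolding entails_def by blast
  then show "holds X t" by (simp add: \<pi>_def)
next
  assume "holds X t"
  then show "entails T0 (atom_of T0 X) t"
    unfolding entails_def
  proof (intro allI impI subsetI)
    fix S :: "nat set" and \<pi> s
    assume \<pi>: "test_interp T0 S \<pi>" and "s \<in> atom_interp S \<pi> (atom_of T0 X)"
    then have "s \<in> S" "{p\<in>T0. s \<in> \<pi> (Prim p)} = X"
      using mem_atom_interp_iff[OF \<pi> assms(1)] by auto
    then show "s \<in> \<pi> t" using mem_interp_iff_holds[OF \<pi> _ assms(2)] \<open>holds X t\<close> by auto
  qed
qed

text \<open>Consistent atoms are the propositional models of the theory: the valuation at a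
  witnessing state is a model, and a model gives a one-state interpretation.\<close>

lemma consistent_atoms_eq:
  assumes "Th \<subseteq> tests T0"
  shows "consistent_atoms T0 Th = atom_of T0 ` {X. X \<subseteq> T0 \<and> (\<forall>t\<in>Th. holds X t)}"
proof (intro Set.equalityI subsetI)
  fix \<delta> assume "\<delta> \<in> consistent_atoms T0 Th"
  then obtain X S and \<pi> :: "'a test \<Rightarrow> nat set" and s where X: "X \<subseteq> T0" "\<delta> = atom_of T0 X"
    and \<pi>: "test_interp T0 S \<pi>" "respects_theory S \<pi> Th" and s: "s \<in> atom_interp S \<pi> \<delta>"
    unfolding consistent_atoms_def atoms_eq by blast
  have "s \<in> S" "{p\<in>T0. s \<in> \<pi> (Prim p)} = X" using s X mem_atom_interp_iff[OF \<pi>(1)] by auto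
  then have "holds X t" if "t \<in> Th" for t
    using that \<pi>(2) mem_interp_iff_holds[OF \<pi>(1), of s t] assms
    by (auto simp: respects_theory_def)
  then show "\<delta> \<in> atom_of T0 ` {X. X \<subseteq> T0 \<and> (\<forall>t\<in>Th. holds X t)}" using X by blast
next
  fix \<delta> assume "\<delta> \<in> atom_of T0 ` {X. X \<subseteq> T0 \<and> (\<forall>t\<in>Th. holds X t)}"
  then obtain X where X: "X \<subseteq> T0" "\<delta> = atom_of T0 X" "\<forall>t\<in>Th. holds X t" by blast
  define \<pi> :: "'a test \<Rightarrow> nat set" where "\<pi> = (\<lambda>t. {s\<in>{0}. holds X t})"
  have \<pi>: "test_interp T0 {0} \<pi>" unfolding \<pi>_def by (rule test_interp_holds)
  moreover have "0 \<in> atom_interp {0} \<pi> \<delta>"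
    using X by (simp add: mem_atom_interp_iff[OF \<pi>]) (auto simp: \<pi>_def)
  moreover have "respects_theory {0} \<pi> Th" using X by (auto simp: respects_theory_def \<pi>_def)
  ultimately show "\<delta> \<in> consistent_atoms T0 Th"
    using X(1,2) unfolding consistent_atoms_def atoms_eq by blast
qed

text \<open>The atom of the valuation at \<open>s\<close>. This labelling pushes a given
  representation forward to the atoms; \<open>test_interp_entails\<close> goes the opposite way,
  from a labelling to an interpretation.\<close>

lemma atom_of_state:
  assumes "Th \<subseteq> tests T0" "test_interp T0 S \<pi>" "respects_theory S \<pi> Th" "s \<in> S"
  obtains \<delta> where "\<delta> \<in> consistent_atoms T0 Th"
    "\<And>t. t \<in> tests T0 \<Longrightarrow> s \<in> \<pi> t \<longleftrightarrow> entails T0 \<delta> t"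
proof
  let ?X = "{p\<in>T0. s \<in> \<pi> (Prim p)}"
  show "atom_of T0 ?X \<in> consistent_atoms T0 Th"
    unfolding consistent_atoms_eq[OF assms(1)]
  proof (intro imageI CollectI conjI ballI)
    fix t assume "t \<in> Th"
    then have "s \<in> \<pi> t" "t \<in> tests T0" using assms by (auto simp: respects_theory_def)
    then show "holds ?X t" using mem_interp_iff_holds[OF assms(2,4)] by simp
  qed auto
  show "s \<in> \<pi> t \<longleftrightarrow> entails T0 (atom_of T0 ?X) t" if "t \<in> tests T0" for t
    using mem_interp_iff_holds[OF assms(2,4) that] entails_iff_holds[of ?X T0 t] that by auto
qed

lemma test_interp_entails:
  assumes "Th \<subseteq> tests T0" "\<And>s. s \<in> S \<Longrightarrow> \<alpha> s \<in> consistent_atoms T0 Th"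
  shows "test_interp T0 S (\<lambda>t. {s\<in>S. entails T0 (\<alpha> s) t})" (is "test_interp _ _ ?\<pi>")
    and "respects_theory S (\<lambda>t. {s\<in>S. entails T0 (\<alpha> s) t}) Th"
proof -
  have "\<forall>s\<in>S. \<exists>X. X \<subseteq> T0 \<and> (\<forall>t\<in>Th. holds X t) \<and> \<alpha> s = atom_of T0 X"
    using assms(2) unfolding consistent_atoms_eq[OF assms(1)] by blast
  then obtain v where v: "\<And>s. s \<in> S \<Longrightarrow> v s \<subseteq> T0" "\<And>s t. s \<in> S \<Longrightarrow> t \<in> Th \<Longrightarrow> holds (v s) t"
    "\<And>s. s \<in> S \<Longrightarrow> \<alpha> s = atom_of T0 (v s)" by metis
  have eq: "?\<pi> t = {s\<in>S. holds (v s) t}" if "t \<in> tests T0" for t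
    by (rule Collect_cong) (use v(3) entails_iff_holds[OF v(1) that] in auto)
  show "test_interp T0 S ?\<pi>"
    unfolding test_interp_def by (auto simp: eq tests.intros)
  show "respects_theory S ?\<pi> Th"
    unfolding respects_theory_def
  proof
    fix t assume "t \<in> Th"
    then show "?\<pi> t = S" using assms(1) v(2) by (subst eq) auto
  qed
qed

section \<open>Choices as vectors of distributions\<close>

lemma choice_fun_range:
  assumes "a \<in> choices T0 A0"
  shows "0 \<le> choice_fun T0 a \<delta> c \<and> choice_fun T0 a \<delta> c \<le> 1"
  using assms
proof (induction arbitrary: \<delta> c)
  case (3 r a b)
  have "r * choice_fun T0 a \<delta> c + (1 - r) * choice_fun T0 b \<delta> c \<le> 1"
    by (rule convex_bound_le) (use 3 in auto)
  then show ?case using 3 by simp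
qed (auto simp: indicator_def)

lemma choice_fun_outside:
  assumes "a \<in> choices T0 A0" "c \<notin> A0"
  shows "choice_fun T0 a \<delta> c = 0"
  using assms by (induction arbitrary: \<delta>) (auto simp: indicator_def)

lemma sum_choice_fun:
  assumes "finite A0" "a \<in> choices T0 A0"
  shows "(\<Sum>c\<in>A0. choice_fun T0 a \<delta> c) = 1"
  using assms(2)
proof induction
  case (1 c)
  then show ?case using assms(1) by (simp add: indicator_def if_distrib cong: if_cong)
next
  case (3 r a b)
  then show ?case by (simp add: sum.distrib sum_distrib_left[symmetric])
qed simp

text \<open>A state sees a choice only through the tests that are true there, hence only through its
  atom: conditionals are resolved as in \<open>choice_fun\<close>, and mixtures are linear on both
  sides.\<close>

lemma choice_interp_eq:
  assumes "finite A0" "a \<in> choices T0 A0"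
    and "\<And>t. t \<in> tests T0 \<Longrightarrow> s \<in> \<pi> t \<longleftrightarrow> entails T0 \<delta> t"
  shows "choice_interp \<pi> \<rho>0 a s x = (\<Sum>c\<in>A0. choice_fun T0 a \<delta> c * \<rho>0 c s x)"
  using assms(2)
proof induction
  case (1 c)
  have "(\<Sum>c'\<in>A0. choice_fun T0 (Basic c) \<delta> c' * \<rho>0 c' s x) = (\<Sum>c'\<in>A0. if c' = c then \<rho>0 c s x else 0)"
    by (intro sum.cong) (auto simp: indicator_def)
  then show ?case using 1 assms(1) by simp
next
  case (2 t a b)
  then show ?case using assms(3) by simp
next
  case (3 r a b)
  then show ?case by (simp add: sum_distrib_left sum.distrib[symmetric] algebra_simps)
qed

text \<open>Inconsistent atoms are left out because \<open>A2_dagger\<close> cannot see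
  them.\<close>

definition score ::
  "'p set \<Rightarrow> 'p test set \<Rightarrow> 'c set \<Rightarrow> ('p atom \<times> 'c \<Rightarrow> real) \<Rightarrow> ('p, 'c) choice \<Rightarrow> real" where
  "score T0 Th A0 f a = (\<Sum>i\<in>consistent_atoms T0 Th \<times> A0. f i * choice_vec T0 a i)"

lemma score_eq:
  "score T0 Th A0 f a
    = (\<Sum>\<delta>\<in>consistent_atoms T0 Th. \<Sum>c\<in>A0. f (\<delta>, c) * choice_fun T0 a \<delta> c)"
proof -
  have "score T0 Th A0 f a
      = (\<Sum>(\<delta>, c)\<in>consistent_atoms T0 Th \<times> A0. f (\<delta>, c) * choice_fun T0 a \<delta> c)"
    unfolding score_def using consistent_atoms_subset[of T0 Th]
    by (intro sum.cong) (auto simp: choice_vec_def)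
  then show ?thesis by (simp add: sum.cartesian_product)
qed

definition score_pref ::
  "'p set \<Rightarrow> 'p test set \<Rightarrow> 'c set \<Rightarrow> ('p, 'c) choice set \<Rightarrow> ('p atom \<times> 'c \<Rightarrow> real) set \<Rightarrow>
   ('p, 'c) pref" where
  "score_pref T0 Th A0 C L =
     {(a, b) \<in> C \<times> C. \<forall>f\<in>L. score T0 Th A0 f b \<le> score T0 Th A0 f a}"

text \<open>Scores are additive, so both sequences have the same total. The first \<open>k\<close>
  pairs weakly favour \<open>a\<close>, hence the remaining \<open>n - k\<close> equal pairs weakly
  favour \<open>b\<close>, and \<open>n - k\<close> is positive.\<close>

lemma A2_dagger_score_pref: "A2_dagger T0 Th C (score_pref T0 Th A0 C L)"
  unfolding A2_dagger_def
proof (intro allI impI)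
  fix n k :: nat and a b :: "nat \<Rightarrow> ('a, 'b) choice"
  assume "k < n" and C: "\<forall>i\<in>{1..n}. a i \<in> C \<and> b i \<in> C"
    and eq: "\<forall>\<delta>\<in>consistent_atoms T0 Th. \<forall>c.
       (\<Sum>i=1..n. choice_fun T0 (a i) \<delta> c) = (\<Sum>i=1..n. choice_fun T0 (b i) \<delta> c)"
    and pref: "\<forall>i\<in>{1..k}. (a i, b i) \<in> score_pref T0 Th A0 C L"
    and const: "\<forall>i\<in>{k+1..n}. a i = a n \<and> b i = b n"
  have *: "score T0 Th A0 f (a n) \<le> score T0 Th A0 f (b n)" if "f \<in> L" for f
  proof -
    define g where "g = score T0 Th A0 f"
    have swap: "(\<Sum>i=1..n. g (e i)) = (\<Sum>\<delta>\<in>consistent_atoms T0 Th. \<Sum>c\<in>A0.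
        f (\<delta>, c) * (\<Sum>i=1..n. choice_fun T0 (e i) \<delta> c))" for e
      unfolding g_def score_eq sum_distrib_left
      by (subst sum.swap[of _ _ "{1..n}"]) (intro sum.cong refl sum.swap)
    have "(\<Sum>i=1..n. g (a i)) = (\<Sum>i=1..n. g (b i))"
      unfolding swap by (intro sum.cong refl) (use eq in simp)
    moreover have split: "(\<Sum>i=1..n. g (e i)) = (\<Sum>i=1..k. g (e i)) + real (n - k) * g (e n)"
      if "\<forall>i\<in>{k+1..n}. e i = e n" for e :: "nat \<Rightarrow> ('a, 'b) choice"
    proof -
      have "(\<Sum>i=1..n. g (e i)) = (\<Sum>i=1..k. g (e i)) + (\<Sum>i=k+1..n. g (e i))"
      proof -
        have "{1..n} = {1..k} \<union> {k+1..n}" using \<open>k < n\<close> by auto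
        then show ?thesis by (simp only:) (rule sum.union_disjoint, auto)
      qed
      also have "(\<Sum>i=k+1..n. g (e i)) = (\<Sum>i=k+1..n. g (e n))"
        using that by (intro sum.cong refl arg_cong[of _ _ g]) blast
      finally show ?thesis by simp
    qed
    moreover have "(\<Sum>i=1..k. g (b i)) \<le> (\<Sum>i=1..k. g (a i))"
      using pref that by (intro sum_mono) (auto simp: score_pref_def g_def)
    moreover have "\<forall>i\<in>{k+1..n}. a i = a n" "\<forall>i\<in>{k+1..n}. b i = b n" using const by blast+
    note split[OF this(1)] split[OF this(2)]
    ultimately have "real (n - k) * g (a n) \<le> real (n - k) * g (b n)"
      by linarith
    then show ?thesis using \<open>k < n\<close> by (simp add: g_def)
  qed
  show "(b n, a n) \<in> score_pref T0 Th A0 C L"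
  proof -
    have "n \<in> {1..n}" using \<open>k < n\<close> by simp
    with C have "a n \<in> C" "b n \<in> C" by blast+
    with * show ?thesis by (simp add: score_pref_def)
  qed
qed

text \<open>Scores depend on a choice only through its vector. Whichever preimages are taken, the
  graph is therefore cut out of the closed square of the vectors of \<open>C\<close> by closed
  half-spaces.\<close>

lemma A3_score_pref:
  assumes "closed_choices T0 C"
  shows "A3 T0 (score_pref T0 Th A0 C L)"
proof -
  define val where "val = (\<lambda>f (v :: 'a atom \<times> 'b \<Rightarrow> real). \<Sum>i\<in>consistent_atoms T0 Th \<times> A0. f i * v i)"
  have val: "score T0 Th A0 f a = val f (choice_vec T0 a)" for f a
    by (simp add: score_def val_def)
  have cont: "continuous_on UNIV (\<lambda>w. val f (h w))" if "continuous_on UNIV h"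
    for f and h :: "('a atom \<times> 'b \<Rightarrow> real) \<times> ('a atom \<times> 'b \<Rightarrow> real) \<Rightarrow> _"
    unfolding val_def
    by (intro continuous_on_sum continuous_on_mult continuous_on_const
        continuous_on_product_then_coordinatewise[OF that])
  have "(\<lambda>(a, b). (choice_vec T0 a, choice_vec T0 b)) ` score_pref T0 Th A0 C L
      = (choice_vec T0 ` C \<times> choice_vec T0 ` C) \<inter> (\<Inter>f\<in>L. {w. val f (snd w) \<le> val f (fst w)})"
    (is "?l = ?r")
  proof (intro Set.equalityI subsetI)
    fix w assume "w \<in> ?l"
    then obtain a b where w: "w = (choice_vec T0 a, choice_vec T0 b)"
      and ab: "(a, b) \<in> score_pref T0 Th A0 C L" by (elim imageE) (auto split: prod.splits)
    from ab show "w \<in> ?r" unfolding w by (simp add: score_pref_def val)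
  next
    fix w assume w: "w \<in> ?r"
    then obtain a b where ab: "a \<in> C" "b \<in> C" and eq: "w = (choice_vec T0 a, choice_vec T0 b)"
      by blast
    with w have "(a, b) \<in> score_pref T0 Th A0 C L" by (simp add: score_pref_def val)
    then show "w \<in> ?l" unfolding eq by (rule rev_image_eqI) simp
  qed
  moreover have "closed (\<Inter>f\<in>L. {w. val f (snd w) \<le> val f (fst w)})"
    by (intro closed_INT ballI closed_Collect_le cont continuous_on_fst continuous_on_snd
        continuous_on_id)
  moreover have "closed (choice_vec T0 ` C \<times> choice_vec T0 ` C)"
    using assms by (auto simp: closed_choices_def intro: closed_Times)
  ultimately show ?thesis
    unfolding A3_def by (simp only: closed_Int)
qed

subsection \<open>Scores separate non-preferences\<close>

lemma tendsto_componentwise: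
  fixes f :: "'n \<Rightarrow> 'i \<Rightarrow> real"
  assumes "\<And>i. ((\<lambda>n. f n i) \<longlongrightarrow> l i) G"
  shows "(f \<longlongrightarrow> l) G"
proof -
  have "limitin (product_topology (\<lambda>i. euclidean) UNIV) f l G"
    unfolding limitin_componentwise using assms by simp
  then show ?thesis by (simp add: euclidean_product_topology)
qed

lemma choice_vec_Mix:
  "choice_vec T0 (Mix r a b) i = r * choice_vec T0 a i + (1 - r) * choice_vec T0 b i"
  by (cases i) (simp add: choice_vec_def)

text \<open>The admixtures \<open>x' n\<close> need not converge: their coordinates are bounded by 1
  and their weight tends to 0.\<close>

lemma choice_vec_Mix_tendsto:
  assumes "\<And>n::nat. x' n \<in> choices T0 A0" "\<And>n. 0 \<le> r n \<and> r n \<le> 1" "r \<longlonglongrightarrow> 1"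
  shows "(\<lambda>n. choice_vec T0 (Mix (r n) x (x' n))) \<longlonglongrightarrow> choice_vec T0 x"
proof (rule tendsto_componentwise)
  fix i
  have bound: "\<bar>choice_vec T0 (x' n) i\<bar> \<le> 1" for n
    using choice_fun_range[OF assms(1)] by (cases i) (auto simp: choice_vec_def abs_le_iff intro: order_trans[of _ 0])
  have "(\<lambda>n. 1 - r n) \<longlonglongrightarrow> 1 - 1" by (intro tendsto_intros assms)
  then have "(\<lambda>n. 1 - r n) \<longlonglongrightarrow> 0" by simp
  then have "(\<lambda>n. (1 - r n) * choice_vec T0 (x' n) i) \<longlonglongrightarrow> 0"
  proof (rule Lim_null_comparison[rotated])
    have "norm ((1 - r n) * choice_vec T0 (x' n) i) \<le> 1 - r n" for n
      using mult_left_mono[OF bound[of n], of "1 - r n"] assms(2)[of n] by (simp add: abs_mult)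
    then show "\<forall>\<^sub>F n in sequentially. norm ((1 - r n) * choice_vec T0 (x' n) i) \<le> 1 - r n"
      by simp
  qed
  then have "(\<lambda>n. r n * choice_vec T0 x i + (1 - r n) * choice_vec T0 (x' n) i)
      \<longlonglongrightarrow> 1 * choice_vec T0 x i + 0"
    by (intro tendsto_intros assms)
  then show "(\<lambda>n. choice_vec T0 (Mix (r n) x (x' n)) i) \<longlonglongrightarrow> choice_vec T0 x i"
    by (simp add: choice_vec_Mix)
qed

lemma score_Mix:
  "score T0 Th A0 f (Mix r a b) = r * score T0 Th A0 f a + (1 - r) * score T0 Th A0 f b"
  unfolding score_def choice_vec_Mix
  by (simp add: sum_distrib_left sum.distrib[symmetric] algebra_simps)

lemma score_cong:
  assumes "\<And>i. i \<in> consistent_atoms T0 Th \<times> A0 \<Longrightarrow> f i = g i"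
  shows "score T0 Th A0 f a = score T0 Th A0 g a"
  unfolding score_def using assms by simp

text \<open>The dual of the cone of preferred directions.\<close>

definition score_dual ::
  "'p set \<Rightarrow> 'p test set \<Rightarrow> 'c set \<Rightarrow> ('p, 'c) pref \<Rightarrow> ('p atom \<times> 'c \<Rightarrow> real) set" where
  "score_dual T0 Th A0 R = {f. \<forall>(a, b)\<in>R. score T0 Th A0 f b \<le> score T0 Th A0 f a}"

text \<open>Since \<open>A3\<close> speaks of vectors, a limit produces only some related pair with
  the right vectors; this transfers the relation to the intended pair. It is cancellation of the
  sequences \<open>a, y\<close> and \<open>b, x\<close>.\<close>

lemma A2_dagger_pair:
  assumes "A2_dagger T0 Th C R" "(a, b) \<in> R" "a \<in> C" "b \<in> C" "x \<in> C" "y \<in> C"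
    and "choice_vec T0 a = choice_vec T0 x" "choice_vec T0 b = choice_vec T0 y"
  shows "(x, y) \<in> R"
proof -
  have eq: "choice_fun T0 a \<delta> c = choice_fun T0 x \<delta> c" "choice_fun T0 b \<delta> c = choice_fun T0 y \<delta> c"
    if "\<delta> \<in> consistent_atoms T0 Th" for \<delta> c
    using fun_cong[OF assms(7), of "(\<delta>, c)"] fun_cong[OF assms(8), of "(\<delta>, c)"]
      consistent_atoms_subset[of T0 Th] that by (auto simp: choice_vec_def)
  define p where "p = (\<lambda>j::nat. if j = 1 then a else y)"
  define q where "q = (\<lambda>j::nat. if j = 1 then b else x)"
  have "(q 2, p 2) \<in> R"
  proof (rule assms(1)[unfolded A2_dagger_def, rule_format, of 1])
    show "(\<Sum>j=1..2. choice_fun T0 (p j) \<delta> c) = (\<Sum>j=1..2. choice_fun T0 (q j) \<delta> c)"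
      if "\<delta> \<in> consistent_atoms T0 Th" for \<delta> c
      using eq[OF that] by (simp add: p_def q_def numeral_2_eq_2)
    show "p j = p 2 \<and> q j = q 2" if "j \<in> {1 + 1..2}" for j
    proof -
      from that have "j = 2" by auto
      then show ?thesis by simp
    qed
  qed (use assms in \<open>auto simp: p_def q_def\<close>)
  then show ?thesis by (simp add: p_def q_def)
qed

lemma separating_score:
  assumes "finite T0" "finite A0" "C \<subseteq> choices T0 A0" "mixture_closed C" "R \<subseteq> C \<times> C"
    and A2: "A2_dagger T0 Th C R" and A3: "A3 T0 R"
    and "x \<in> C" "y \<in> C" "(x, y) \<notin> R"
  obtains f where "f \<in> score_dual T0 Th A0 R" "score T0 Th A0 f x < score T0 Th A0 f y"
proof -
  let ?I = "consistent_atoms T0 Th \<times> A0"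
  interpret cancellative_preference C ?I "choice_vec T0" Mix R
  proof
    show "finite ?I"
      using finite_subset[OF consistent_atoms_subset finite_atoms] assms by blast
    show "R \<subseteq> C \<times> C" by fact
    show "Mix r x y \<in> C" if "0 \<le> r" "r \<le> 1" "x \<in> C" "y \<in> C" for r x y
      using that assms(4) by (auto simp: mixture_closed_def)
    show "choice_vec T0 (Mix r x y) i = r * choice_vec T0 x i + (1 - r) * choice_vec T0 y i" for r x y i
      by (rule choice_vec_Mix)
  next
    fix n k :: nat and a b
    assume n: "k < n" "\<And>j. j \<in> {1..n} \<Longrightarrow> a j \<in> C \<and> b j \<in> C"
      and sums: "\<And>i. i \<in> ?I \<Longrightarrow> (\<Sum>j=1..n. choice_vec T0 (a j) i) = (\<Sum>j=1..n. choice_vec T0 (b j) i)"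
      and R: "\<And>j. j \<in> {1..k} \<Longrightarrow> (a j, b j) \<in> R"
      and const: "\<And>j. j \<in> {k+1..n} \<Longrightarrow> a j = a n \<and> b j = b n"
    show "(b n, a n) \<in> R"
    proof (rule A2[unfolded A2_dagger_def, rule_format])
      fix \<delta> c assume \<delta>: "\<delta> \<in> consistent_atoms T0 Th"
      \<comment> \<open>\<open>A2_dagger\<close> asks for equality at every \<open>c\<close> of the
        type, the coordinates provide it on \<open>A0\<close>; elsewhere both sums vanish.\<close>
      show "(\<Sum>j=1..n. choice_fun T0 (a j) \<delta> c) = (\<Sum>j=1..n. choice_fun T0 (b j) \<delta> c)"
      proof (cases "c \<in> A0")
        case True
        then show ?thesis using sums[of "(\<delta>, c)"] \<delta> consistent_atoms_subset[of T0 Th]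
          by (auto simp: choice_vec_def subset_iff)
      next
        case False
        have "choice_fun T0 (a j) \<delta> c = 0 \<and> choice_fun T0 (b j) \<delta> c = 0" if "j \<in> {1..n}" for j
          using n(2)[OF that] assms(3) choice_fun_outside[OF _ False] by blast
        then show ?thesis by simp
      qed
    qed (rule n(1), erule n(2), erule R, erule const)
  next
    fix r x y and x' y' :: "nat \<Rightarrow> _"
    assume C: "x \<in> C" "y \<in> C" "\<And>n. x' n \<in> C" "\<And>n. y' n \<in> C"
      and r: "\<And>n. 0 \<le> r n \<and> r n \<le> 1" "r \<longlonglongrightarrow> 1"
      and R: "\<And>n. (Mix (r n) x (x' n), Mix (r n) y (y' n)) \<in> R"
    let ?v = "\<lambda>(a, b). (choice_vec T0 a, choice_vec T0 b)"
    have "?v (x, y) \<in> ?v ` R"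
    proof (rule closed_sequentially)
      show "closed (?v ` R)" using A3 by (simp add: A3_def)
      show "?v (Mix (r n) x (x' n), Mix (r n) y (y' n)) \<in> ?v ` R" for n using R by (rule imageI)
      have "\<And>n. x' n \<in> choices T0 A0" "\<And>n. y' n \<in> choices T0 A0" using C assms(3) by blast+
      then show "(\<lambda>n. ?v (Mix (r n) x (x' n), Mix (r n) y (y' n))) \<longlonglongrightarrow> ?v (x, y)"
        unfolding prod.case by (intro tendsto_Pair choice_vec_Mix_tendsto[OF _ r])
    qed
    then obtain a b where "(a, b) \<in> R" "choice_vec T0 a = choice_vec T0 x" "choice_vec T0 b = choice_vec T0 y"
      by auto
    then show "(x, y) \<in> R" using A2_dagger_pair[OF A2] C assms(5) by blast
  qed
  show ?thesis
  proof (rule separating_functional[OF assms(8-10)])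
    fix f
    assume "\<And>a b. (a, b) \<in> R \<Longrightarrow> (\<Sum>i\<in>?I. f i * choice_vec T0 b i) \<le> (\<Sum>i\<in>?I. f i * choice_vec T0 a i)"
      and "(\<Sum>i\<in>?I. f i * choice_vec T0 x i) < (\<Sum>i\<in>?I. f i * choice_vec T0 y i)"
    then show thesis by (intro that[of f]) (auto simp: score_dual_def score_def)
  qed
qed

text \<open>A bipolar statement: for each missing pair, \<open>separating_score\<close> supplies a
  member of the dual that rejects it.\<close>

lemma score_pref_dual:
  assumes "finite T0" "finite A0" "C \<subseteq> choices T0 A0" "mixture_closed C" "R \<subseteq> C \<times> C"
    and "A2_dagger T0 Th C R" and "A3 T0 R"
  shows "R = score_pref T0 Th A0 C (score_dual T0 Th A0 R)"
proof (intro Set.equalityI subrelI)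
  fix a b assume "(a, b) \<in> R"
  then show "(a, b) \<in> score_pref T0 Th A0 C (score_dual T0 Th A0 R)"
    using assms(5) by (auto simp: score_pref_def score_dual_def)
next
  fix a b assume "(a, b) \<in> score_pref T0 Th A0 C (score_dual T0 Th A0 R)"
  then have ab: "a \<in> C" "b \<in> C"
    and le: "\<And>f. f \<in> score_dual T0 Th A0 R \<Longrightarrow> score T0 Th A0 f b \<le> score T0 Th A0 f a"
    by (auto simp: score_pref_def)
  show "(a, b) \<in> R"
  proof (rule ccontr)
    assume "(a, b) \<notin> R"
    with ab obtain f where "f \<in> score_dual T0 Th A0 R" "score T0 Th A0 f a < score T0 Th A0 f b"
      using separating_score[OF assms] by blast
    with le[of f] show False by simp
  qed
qed

text \<open>A functional of the dual that is strict somewhere already represents a complete relation: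
  where it is indifferent, completeness decides slightly perturbed comparisons.\<close>

lemma complete_score_pref:
  assumes "finite T0" "finite A0" "C \<subseteq> choices T0 A0" "mixture_closed C" "R \<subseteq> C \<times> C"
    and "A2_dagger T0 Th C R" and "A3 T0 R" and "A1 C R"
  obtains f where "R = score_pref T0 Th A0 C {f}"
proof (cases "C \<times> C \<subseteq> R")
  case True
  \<comment> \<open>The universal relation offers no strict pair to perturb with, and the zero
    functional represents it.\<close>
  then have "R = score_pref T0 Th A0 C {\<lambda>_. 0}"
    using assms(5) by (auto simp: score_pref_def score_def)
  then show ?thesis by (rule that)
next
  case False
  then obtain x y where xy: "x \<in> C" "y \<in> C" "(x, y) \<notin> R" by blast
  obtain f where f: "f \<in> score_dual T0 Th A0 R" "score T0 Th A0 f x < score T0 Th A0 f y"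
    using separating_score[OF assms(1-7) xy] by blast
  have "R = score_pref T0 Th A0 C {f}"
  proof (intro Set.equalityI subrelI)
    fix a b assume "(a, b) \<in> R"
    then show "(a, b) \<in> score_pref T0 Th A0 C {f}"
      using f(1) assms(5) by (auto simp: score_pref_def score_dual_def)
  next
    fix a b assume "(a, b) \<in> score_pref T0 Th A0 C {f}"
    then have ab: "a \<in> C" "b \<in> C" "score T0 Th A0 f b \<le> score T0 Th A0 f a"
      by (auto simp: score_pref_def)
    show "(a, b) \<in> R"
    proof (rule ccontr)
      assume "(a, b) \<notin> R"
      then obtain g where g: "g \<in> score_dual T0 Th A0 R" "score T0 Th A0 g a < score T0 Th A0 g b"
        using separating_score[OF assms(1-7) ab(1,2)] by blast
      let ?A = "score T0 Th A0 g b - score T0 Th A0 g a"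
      let ?B = "score T0 Th A0 g y - score T0 Th A0 g x"
      have "0 \<le> - ?A"
      proof (rule nonneg_of_small_perturbations)
        fix s :: real assume s: "0 < s" "s \<le> 1"
        \<comment> \<open>As \<open>f\<close> ranks \<open>y\<close> strictly above
          \<open>x\<close>, the admixture makes its weak preference for \<open>a\<close> strict.
          Hence \<open>(?b, ?a)\<close> is not in \<open>R\<close>, completeness gives
          \<open>(?a, ?b)\<close>, and \<open>g\<close> has to agree for every \<open>s\<close>;
          letting \<open>s\<close> tend to 0 contradicts its strict preference for
          \<open>b\<close>.\<close>
        let ?a = "Mix (1 - s) a y" and ?b = "Mix (1 - s) b x"
        have C: "?a \<in> C" "?b \<in> C" using assms(4) s ab xy by (auto simp: mixture_closed_def)
        have "(1 - s) * score T0 Th A0 f b \<le> (1 - s) * score T0 Th A0 f a"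
          using s ab by (intro mult_left_mono) auto
        moreover have "s * score T0 Th A0 f x < s * score T0 Th A0 f y" using s f by simp
        ultimately have "score T0 Th A0 f ?b < score T0 Th A0 f ?a" by (simp add: score_Mix)
        moreover have "score T0 Th A0 f ?a \<le> score T0 Th A0 f ?b" if "(?b, ?a) \<in> R"
          using f(1) that by (simp add: score_dual_def split_beta Ball_def)
        ultimately have "(?b, ?a) \<notin> R" by fastforce
        then have "(?a, ?b) \<in> R" using assms(8) C by (auto simp: A1_def)
        then have "score T0 Th A0 g ?b \<le> score T0 Th A0 g ?a"
          using g(1) by (auto simp: score_dual_def)
        then have "0 \<le> - ?A + s * (?A + ?B)" by (simp add: score_Mix algebra_simps)
        then have "0 \<le> 2 * s * (- ?A + s * (?A + ?B))" using s by (intro mult_nonneg_nonneg) auto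
        then show "0 \<le> 2 * s * - ?A + s\<^sup>2 * (2 * (?A + ?B))"
          by (simp add: power2_eq_square algebra_simps)
      qed
      with g(2) show False by simp
    qed
  qed
  then show ?thesis by (rule that)
qed

text \<open>The state space may be infinite, as it can be over the complete extensions; a
  probability carried by the finite set \<open>F\<close> reduces the infinite sum to a finite one.
  The inner sum is the expected utility of the primitive choice \<open>c\<close> at
  \<open>s\<close>.\<close>

lemma expected_utility_eq:
  assumes "finite A0" "a \<in> choices T0 A0" "finite Out" "finite F" "F \<subseteq> S"
    and "\<And>s. s \<in> S - F \<Longrightarrow> p s = 0"
    and "\<And>s t. s \<in> F \<Longrightarrow> t \<in> tests T0 \<Longrightarrow> s \<in> \<pi> t \<longleftrightarrow> entails T0 (\<alpha> s) t"
  shows "expected_utility S Out (choice_interp \<pi> \<rho>0 a) u p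
    = (\<Sum>s\<in>F. \<Sum>c\<in>A0. p s * (\<Sum>x\<in>Out. u x * \<rho>0 c s x) * choice_fun T0 a (\<alpha> s) c)"
proof -
  have "s \<in> F" if "s \<in> S" "p s \<noteq> 0" for s using assms(6) that by blast
  note p = this
  have "expected_utility S Out (choice_interp \<pi> \<rho>0 a) u p
      = (\<Sum>(s, x)\<in>F \<times> Out. u x * choice_interp \<pi> \<rho>0 a s x * p s)"
    unfolding expected_utility_def
    by (rule infsumI, rule has_sum_finite_neutralI[where B = "F \<times> Out"])
      (use p assms(3-5) in auto)
  also have "\<dots> = (\<Sum>s\<in>F. \<Sum>x\<in>Out. u x * choice_interp \<pi> \<rho>0 a s x * p s)"
    by (rule sum.cartesian_product[symmetric])
  also have "\<dots> = (\<Sum>s\<in>F. \<Sum>c\<in>A0. p s * (\<Sum>x\<in>Out. u x * \<rho>0 c s x) * choice_fun T0 a (\<alpha> s) c)"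
  proof (intro sum.cong refl)
    fix s assume "s \<in> F"
    have ci: "choice_interp \<pi> \<rho>0 a s x = (\<Sum>c\<in>A0. choice_fun T0 a (\<alpha> s) c * \<rho>0 c s x)" for x
      using assms(1,2) assms(7)[OF \<open>s \<in> F\<close>] by (rule choice_interp_eq)
    have "(\<Sum>x\<in>Out. u x * choice_interp \<pi> \<rho>0 a s x * p s)
        = (\<Sum>x\<in>Out. \<Sum>c\<in>A0. p s * (u x * \<rho>0 c s x) * choice_fun T0 a (\<alpha> s) c)"
      unfolding ci sum_distrib_left sum_distrib_right
      by (intro sum.cong refl) (simp add: mult_ac)
    also have "\<dots> = (\<Sum>c\<in>A0. \<Sum>x\<in>Out. p s * (u x * \<rho>0 c s x) * choice_fun T0 a (\<alpha> s) c)"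
      by (rule sum.swap)
    finally show "(\<Sum>x\<in>Out. u x * choice_interp \<pi> \<rho>0 a s x * p s)
        = (\<Sum>c\<in>A0. p s * (\<Sum>x\<in>Out. u x * \<rho>0 c s x) * choice_fun T0 a (\<alpha> s) c)"
      by (simp add: sum_distrib_left sum_distrib_right)
  qed
  finally show ?thesis .
qed

lemma SEU_representation_score_pref:
  assumes "finite T0" "finite A0" "Th \<subseteq> tests T0" "C \<subseteq> choices T0 A0" "R \<subseteq> C \<times> C" "finite S"
    and rep: "SEU_representation T0 A0 Th C R S Out U P V \<pi> \<rho>0"
  obtains L where "R = score_pref T0 Th A0 C L"
proof -
  let ?At = "consistent_atoms T0 Th"
  have interp: "test_interp T0 S \<pi>" "respects_theory S \<pi> Th" and "finite Out"
    using rep by (auto simp: SEU_representation_def)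
  have "\<forall>s\<in>S. \<exists>\<delta>\<in>?At. \<forall>t\<in>tests T0. s \<in> \<pi> t \<longleftrightarrow> entails T0 \<delta> t"
    using atom_of_state[OF assms(3) interp] by metis
  then obtain \<alpha> where \<alpha>: "\<And>s. s \<in> S \<Longrightarrow> \<alpha> s \<in> ?At"
    "\<And>s t. s \<in> S \<Longrightarrow> t \<in> tests T0 \<Longrightarrow> s \<in> \<pi> t \<longleftrightarrow> entails T0 (\<alpha> s) t" by metis
  have fin: "finite ?At" using finite_subset[OF consistent_atoms_subset finite_atoms] assms by blast
  \<comment> \<open>The coefficient at \<open>(\<delta>, c)\<close> collects the weighted utilities
    of \<open>c\<close> over all states labelled \<open>\<delta>\<close>, so that grouping the
    states by their atom turns expected utility into a score.\<close>
  define f where "f = (\<lambda>(u, p) (\<delta>, c). \<Sum>s | s \<in> S \<and> \<alpha> s = \<delta>. p s * (\<Sum>x\<in>Out. u x * \<rho>0 c s x))"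
  have EU: "expected_utility S Out (choice_interp \<pi> \<rho>0 a) u p = score T0 Th A0 (f (u, p)) a"
    if "a \<in> C" for a u p
  proof -
    have "a \<in> choices T0 A0" using that assms(4) by blast
    then have "expected_utility S Out (choice_interp \<pi> \<rho>0 a) u p
        = (\<Sum>s\<in>S. \<Sum>c\<in>A0. p s * (\<Sum>x\<in>Out. u x * \<rho>0 c s x) * choice_fun T0 a (\<alpha> s) c)"
      using \<open>finite Out\<close> assms(2,6) \<alpha>(2) by (intro expected_utility_eq) auto
    also have "\<dots> = (\<Sum>\<delta>\<in>?At. \<Sum>s | s \<in> S \<and> \<alpha> s = \<delta>.
        \<Sum>c\<in>A0. p s * (\<Sum>x\<in>Out. u x * \<rho>0 c s x) * choice_fun T0 a (\<alpha> s) c)"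
      using assms(6) fin \<alpha>(1) by (intro sum.group[symmetric]) auto
    also have "\<dots> = (\<Sum>\<delta>\<in>?At. \<Sum>c\<in>A0. f (u, p) (\<delta>, c) * choice_fun T0 a \<delta> c)"
      unfolding f_def prod.case sum_distrib_right
      by (intro sum.cong refl, subst sum.swap) (intro sum.cong refl, auto)
    finally show ?thesis by (simp add: score_eq)
  qed
  have iff: "(a, b) \<in> R \<longleftrightarrow> (\<forall>(u, p)\<in>V.
      expected_utility S Out (choice_interp \<pi> \<rho>0 b) u p
      \<le> expected_utility S Out (choice_interp \<pi> \<rho>0 a) u p)" if "a \<in> C" "b \<in> C" for a b
    using rep that by (simp add: SEU_representation_def)
  have "R = score_pref T0 Th A0 C (f ` V)"
  proof (intro Set.equalityI subrelI)
    fix a b assume "(a, b) \<in> R"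
    moreover from this have "a \<in> C" "b \<in> C" using assms(5) by auto
    ultimately show "(a, b) \<in> score_pref T0 Th A0 C (f ` V)"
      using iff by (auto simp: score_pref_def EU)
  next
    fix a b assume "(a, b) \<in> score_pref T0 Th A0 C (f ` V)"
    then show "(a, b) \<in> R" using iff by (auto simp: score_pref_def EU)
  qed
  then show ?thesis by (rule that)
qed

subsection \<open>Representations with uniform and with bet states\<close>

lemma finite_consistent_atoms: "finite T0 \<Longrightarrow> finite (consistent_atoms T0 Th)"
  by (rule finite_subset[OF consistent_atoms_subset finite_atoms])

lemma expected_utility_deterministic:
  assumes "finite A0" "a \<in> choices T0 A0" "finite Out" "finite F" "F \<subseteq> S"
    and "\<And>s. s \<notin> F \<Longrightarrow> p s = 0"
    and out: "\<And>s c. s \<in> F \<Longrightarrow> c \<in> A0 \<Longrightarrow> out s c \<in> Out"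
  shows "expected_utility S Out
      (choice_interp (\<lambda>t. {s\<in>S. entails T0 (\<alpha> s) t}) (\<lambda>c s. indicator {out s c}) a) u p
    = (\<Sum>s\<in>F. \<Sum>c\<in>A0. p s * u (out s c) * choice_fun T0 a (\<alpha> s) c)"
proof -
  have "expected_utility S Out
      (choice_interp (\<lambda>t. {s\<in>S. entails T0 (\<alpha> s) t}) (\<lambda>c s. indicator {out s c}) a) u p
    = (\<Sum>s\<in>F. \<Sum>c\<in>A0. p s * (\<Sum>x\<in>Out. u x * indicator {out s c} x) * choice_fun T0 a (\<alpha> s) c)"
    using assms(1-6) by (intro expected_utility_eq) auto
  also have "\<dots> = (\<Sum>s\<in>F. \<Sum>c\<in>A0. p s * u (out s c) * choice_fun T0 a (\<alpha> s) c)"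
    using out assms(3) by (intro sum.cong refl) (simp add: indicator_def if_distrib cong: if_cong)
  finally show ?thesis .
qed

text \<open>The common frame of all constructions below: states are labelled by atoms, and
  \<open>out\<close> tabulates the outcomes. \<open>E\<close> is expected utility in whatever form
  suits the construction, so that \<open>R\<close> is checked on finite sums.\<close>

lemma SEU_representationI:
  assumes "finite A0" "Th \<subseteq> tests T0" "C \<subseteq> choices T0 A0"
    and "finite Out" "U \<subseteq> utilities Out" "P \<subseteq> prob_dists S" "closed P" "V \<subseteq> U \<times> P" "closed V"
    and "finite F" "F \<subseteq> S" and supp: "\<And>p s. p \<in> P \<Longrightarrow> s \<notin> F \<Longrightarrow> p s = 0"
    and at: "\<And>s. s \<in> S \<Longrightarrow> \<alpha> s \<in> consistent_atoms T0 Th"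
    and out: "\<And>s c. s \<in> S \<Longrightarrow> c \<in> A0 \<Longrightarrow> out s c \<in> Out"
    and E: "\<And>u p a. (u, p) \<in> V \<Longrightarrow> a \<in> C \<Longrightarrow>
      E u p a = (\<Sum>s\<in>F. \<Sum>c\<in>A0. p s * u (out s c) * choice_fun T0 a (\<alpha> s) c)"
    and R: "\<And>a b. a \<in> C \<Longrightarrow> b \<in> C \<Longrightarrow> (a, b) \<in> R \<longleftrightarrow> (\<forall>(u, p)\<in>V. E u p b \<le> E u p a)"
  shows "SEU_representation T0 A0 Th C R S Out U P V
    (\<lambda>t. {s\<in>S. entails T0 (\<alpha> s) t}) (\<lambda>c s. indicator {out s c})"
proof -
  have EU: "expected_utility S Out
      (choice_interp (\<lambda>t. {s\<in>S. entails T0 (\<alpha> s) t}) (\<lambda>c s. indicator {out s c}) a) u p = E u p a"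
    if "(u, p) \<in> V" "a \<in> C" for u p a
  proof -
    have "p \<in> P" using that(1) assms(8) by blast
    moreover have "a \<in> choices T0 A0" using that(2) assms(3) by blast
    ultimately show ?thesis unfolding E[OF that]
      using assms(1,4,10,11) supp out by (intro expected_utility_deterministic) auto
  qed
  have "(a, b) \<in> R \<longleftrightarrow> (\<forall>(u, p)\<in>V.
      expected_utility S Out
        (choice_interp (\<lambda>t. {s\<in>S. entails T0 (\<alpha> s) t}) (\<lambda>c s. indicator {out s c}) a) u p
      \<ge> expected_utility S Out
        (choice_interp (\<lambda>t. {s\<in>S. entails T0 (\<alpha> s) t}) (\<lambda>c s. indicator {out s c}) b) u p)"
    if "a \<in> C" "b \<in> C" for a b
    unfolding R[OF that] using EU that by (intro ball_cong) auto
  then show ?thesis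
    unfolding SEU_representation_def
    using assms(4-9) test_interp_entails[OF assms(2) at]
    by (intro conjI ballI) (auto simp: point_masses_def out)
qed

lemma prob_dists_iff:
  assumes "finite F" "F \<subseteq> S" "\<And>s. s \<notin> F \<Longrightarrow> p s = 0"
  shows "p \<in> prob_dists S \<longleftrightarrow> (\<forall>s. 0 \<le> p s) \<and> sum p F = 1"
proof -
  have "(p has_sum 1) S \<longleftrightarrow> (p has_sum 1) F"
    using assms by (intro has_sum_cong_neutral) auto
  also have "\<dots> \<longleftrightarrow> sum p F = 1" using has_sum_finite_iff[OF assms(1)] by metis
  finally show ?thesis using assms by (auto simp: prob_dists_def)
qed

lemma closed_score_constraints:
  assumes "\<And>i. i \<in> consistent_atoms T0 Th \<times> A0 \<Longrightarrow> continuous_on UNIV (\<lambda>w. g w i)"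
  shows "closed {w. g w \<in> score_dual T0 Th A0 R}"
proof -
  have "continuous_on UNIV (\<lambda>w. score T0 Th A0 (g w) a)" for a
    unfolding score_def by (intro continuous_on_sum continuous_on_mult continuous_on_const assms)
  then have "closed (\<Inter>(a, b)\<in>R. {w. score T0 Th A0 (g w) b \<le> score T0 Th A0 (g w) a})"
    by (intro closed_INT) (auto intro!: closed_Collect_le)
  moreover have "(\<Inter>(a, b)\<in>R. {w. score T0 Th A0 (g w) b \<le> score T0 Th A0 (g w) a})
      = {w. g w \<in> score_dual T0 Th A0 R}"
    by (auto simp: score_dual_def)
  ultimately show ?thesis by simp
qed

text \<open>Each coordinate has an outcome of its own, so utilities are functionals up to the
  numbering \<open>h\<close>, and expected utility is the score divided by the number of atoms.
  \<open>U\<close> is left open because it is later filled both with the whole dual and with a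
  single functional.\<close>

lemma uniform_state_representation:
  assumes "finite T0" "finite A0" "Th \<subseteq> tests T0" "C \<subseteq> choices T0 A0"
    and "consistent_atoms T0 Th \<noteq> {}"
  obtains S Out :: "nat set" and h p \<pi> \<rho>0 where "finite S"
    "inj_on h (consistent_atoms T0 Th \<times> A0)" "h ` (consistent_atoms T0 Th \<times> A0) = Out"
    "\<And>U. U \<subseteq> utilities Out \<Longrightarrow> closed U \<Longrightarrow> SEU_representation T0 A0 Th C
       (score_pref T0 Th A0 C ((\<lambda>u. u \<circ> h) ` U)) S Out U {p} (U \<times> {p}) \<pi> \<rho>0"
proof -
  let ?At = "consistent_atoms T0 Th"
  have fin: "finite ?At" using assms(1) by (rule finite_consistent_atoms)
  obtain g :: "_ \<Rightarrow> nat" where g: "inj_on g ?At" using finite_imp_inj_to_nat_seg[OF fin] by blast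
  have finI: "finite (?At \<times> A0)" using fin assms(2) by simp
  obtain h :: "_ \<Rightarrow> nat" where h: "inj_on h (?At \<times> A0)"
    using finite_imp_inj_to_nat_seg[OF finI] by blast
  define S where "S = g ` ?At"
  define Out where "Out = h ` (?At \<times> A0)"
  define N where "N = real (card ?At)"
  have "0 < N" using fin assms(5) by (simp add: N_def card_gt_0_iff)
  define p where "p = (\<lambda>s. if s \<in> S then 1 / N else 0)"
  define \<alpha> where "\<alpha> = inv_into ?At g"
  have \<alpha>: "\<alpha> (g \<delta>) = \<delta>" if "\<delta> \<in> ?At" for \<delta> using g that by (simp add: \<alpha>_def)
  have "finite S" "finite Out" using fin assms(2) by (auto simp: S_def Out_def)
  have "card S = card ?At" unfolding S_def by (rule card_image[OF g])
  have p: "p \<in> prob_dists S"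
    using \<open>finite S\<close> \<open>0 < N\<close> \<open>card S = card ?At\<close>
    by (subst prob_dists_iff[of S]) (auto simp: p_def N_def)
  have "SEU_representation T0 A0 Th C (score_pref T0 Th A0 C ((\<lambda>u. u \<circ> h) ` U)) S Out U {p}
      (U \<times> {p}) (\<lambda>t. {s\<in>S. entails T0 (\<alpha> s) t}) (\<lambda>c s. indicator {h (\<alpha> s, c)})"
    if U: "U \<subseteq> utilities Out" "closed U" for U
  proof (rule SEU_representationI[where F = S
        and E = "\<lambda>u p a. (1 / N) * score T0 Th A0 (u \<circ> h) a"])
    show "1 / N * score T0 Th A0 (u \<circ> h) a
        = (\<Sum>s\<in>S. \<Sum>c\<in>A0. p' s * u (h (\<alpha> s, c)) * choice_fun T0 a (\<alpha> s) c)"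
      if "(u, p') \<in> U \<times> {p}" "a \<in> C" for u p' a
      unfolding S_def score_eq sum_distrib_left sum.reindex[OF g]
      using that \<alpha> by (intro sum.cong refl) (auto simp: p_def S_def)
    show "(a, b) \<in> score_pref T0 Th A0 C ((\<lambda>u. u \<circ> h) ` U) \<longleftrightarrow> (\<forall>(u, p)\<in>U \<times> {p}.
        1 / N * score T0 Th A0 (u \<circ> h) b \<le> 1 / N * score T0 Th A0 (u \<circ> h) a)"
      if "a \<in> C" "b \<in> C" for a b
      using that \<open>0 < N\<close> by (auto simp: score_pref_def divide_le_cancel)
    show "\<alpha> s \<in> ?At" if "s \<in> S" for s using that \<alpha> by (auto simp: S_def)
    show "h (\<alpha> s, c) \<in> Out" if "s \<in> S" "c \<in> A0" for s c
      using that \<alpha> by (auto simp: S_def Out_def)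
  qed (use assms p U \<open>finite S\<close> \<open>finite Out\<close> in \<open>auto simp: p_def closed_Times\<close>)
  then show ?thesis by (intro that[OF \<open>finite S\<close> h]) (auto simp: Out_def)
qed

text \<open>A state in the image of \<open>\<eta>\<close> is a bet on one primitive choice: the outcome of \<open>c\<close> in the
  state \<open>\<eta> (\<delta>, c')\<close> is \<open>1\<close> if \<open>c = c'\<close> and \<open>0\<close> otherwise. The utility is the identity on these
  outcomes, so that the probabilities play the role of the functionals. A functional becomes
  nonnegative by adding a constant, which changes all scores by the same amount.\<close>

lemma bet_state_representation:
  fixes \<eta> :: "'p atom \<times> 'c \<Rightarrow> 's"
  assumes "finite T0" "finite A0" "Th \<subseteq> tests T0" "C \<subseteq> choices T0 A0" "mixture_closed C"
    and "R \<subseteq> C \<times> C" "A2_dagger T0 Th C R" "A3 T0 R"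
    and \<eta>: "inj_on \<eta> (consistent_atoms T0 Th \<times> A0)" "\<eta> ` (consistent_atoms T0 Th \<times> A0) \<subseteq> S"
    and at: "\<And>s. s \<in> S \<Longrightarrow> \<alpha> s \<in> consistent_atoms T0 Th"
    and at_\<eta>: "\<And>\<delta> c. \<delta> \<in> consistent_atoms T0 Th \<Longrightarrow> c \<in> A0 \<Longrightarrow> \<alpha> (\<eta> (\<delta>, c)) = \<delta>"
  shows "\<exists>(Out::nat set) u P V \<pi> \<rho>0. SEU_representation T0 A0 Th C R S Out {u} P V \<pi> \<rho>0"
proof -
  let ?At = "consistent_atoms T0 Th"
  let ?I = "?At \<times> A0"
  define F where "F = \<eta> ` ?I"
  define out where "out = (\<lambda>s c. if s = \<eta> (\<alpha> s, c) then 1 else 0 :: nat)"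
  define u :: "nat \<Rightarrow> real" where "u = indicator {1}"
  \<comment> \<open>All probabilities on the bets that respect the preference are taken, not only
    the normalised functionals constructed below, because each of these conditions is
    closed.\<close>
  define P where "P = {p\<in>prob_dists S. (\<forall>s. s \<notin> F \<longrightarrow> p s = 0) \<and> p \<circ> \<eta> \<in> score_dual T0 Th A0 R}"
  have finI: "finite ?I" using finite_consistent_atoms assms(1,2) by blast
  have F: "finite F" "F \<subseteq> S" using finI \<eta>(2) by (auto simp: F_def)
  have cont: "continuous_on UNIV (\<lambda>p :: 's \<Rightarrow> real. p s)" for s by simp
  have P_eq: "P = {p. \<forall>s. 0 \<le> p s} \<inter> {p. \<forall>s. s \<notin> F \<longrightarrow> p s = 0} \<inter> {p. sum p F = 1}
      \<inter> {p. p \<circ> \<eta> \<in> score_dual T0 Th A0 R}"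
    unfolding P_def using prob_dists_iff[OF F] by blast
  have "closed P"
    unfolding P_eq
  proof (intro closed_Int)
    show "closed {p :: 's \<Rightarrow> real. \<forall>s. 0 \<le> p s}"
      by (intro closed_Collect_all closed_Collect_le cont continuous_on_const)
    show "closed {p :: 's \<Rightarrow> real. \<forall>s. s \<notin> F \<longrightarrow> p s = 0}"
      by (intro closed_Collect_all closed_Collect_imp open_Collect_const closed_Collect_eq
          cont continuous_on_const)
    show "closed {p :: 's \<Rightarrow> real. sum p F = 1}"
      by (intro closed_Collect_eq continuous_on_sum cont continuous_on_const)
    show "closed {p :: 's \<Rightarrow> real. p \<circ> \<eta> \<in> score_dual T0 Th A0 R}"
      by (intro closed_score_constraints) (simp add: cont)
  qed
  have "SEU_representation T0 A0 Th C R S {0, 1} {u} P ({u} \<times> P)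
      (\<lambda>t. {s\<in>S. entails T0 (\<alpha> s) t}) (\<lambda>c s. indicator {out s c})"
  proof (rule SEU_representationI[where F = F and E = "\<lambda>u p a. score T0 Th A0 (p \<circ> \<eta>) a"])
    show "score T0 Th A0 (p \<circ> \<eta>) a
        = (\<Sum>s\<in>F. \<Sum>c\<in>A0. p s * u' (out s c) * choice_fun T0 a (\<alpha> s) c)"
      if "(u', p) \<in> {u} \<times> P" "a \<in> C" for u' p a
    proof -
      have "(\<Sum>s\<in>F. \<Sum>c\<in>A0. p s * u (out s c) * choice_fun T0 a (\<alpha> s) c)
          = (\<Sum>(\<delta>, c')\<in>?I. \<Sum>c\<in>A0. p (\<eta> (\<delta>, c')) * u (out (\<eta> (\<delta>, c')) c) * choice_fun T0 a \<delta> c)"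
        unfolding F_def sum.reindex[OF \<eta>(1)]
        by (intro sum.cong refl) (auto simp: at_\<eta>)
      also have "\<dots> = (\<Sum>(\<delta>, c')\<in>?I. p (\<eta> (\<delta>, c')) * choice_fun T0 a \<delta> c')"
      proof (intro sum.cong refl, clarify)
        fix \<delta> c' assume i: "\<delta> \<in> ?At" "c' \<in> A0"
        have "u (out (\<eta> (\<delta>, c')) c) = (if c = c' then 1 else 0)" if "c \<in> A0" for c
          using i that \<eta>(1) by (auto simp: out_def u_def at_\<eta> inj_on_def)
        then have "(\<Sum>c\<in>A0. p (\<eta> (\<delta>, c')) * u (out (\<eta> (\<delta>, c')) c) * choice_fun T0 a \<delta> c)
            = (\<Sum>c\<in>A0. if c = c' then p (\<eta> (\<delta>, c')) * choice_fun T0 a \<delta> c' else 0)"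
          by (intro sum.cong) auto
        then show "(\<Sum>c\<in>A0. p (\<eta> (\<delta>, c')) * u (out (\<eta> (\<delta>, c')) c) * choice_fun T0 a \<delta> c)
            = p (\<eta> (\<delta>, c')) * choice_fun T0 a \<delta> c'"
          using i assms(2) by simp
      qed
      also have "\<dots> = score T0 Th A0 (p \<circ> \<eta>) a"
        unfolding score_eq by (simp add: sum.cartesian_product)
      finally show ?thesis using that by simp
    qed
    show "(a, b) \<in> R \<longleftrightarrow> (\<forall>(u, p)\<in>{u} \<times> P. score T0 Th A0 (p \<circ> \<eta>) b \<le> score T0 Th A0 (p \<circ> \<eta>) a)"
      if ab: "a \<in> C" "b \<in> C" for a b
    proof
      assume "(a, b) \<in> R"
      then show "\<forall>(u, p)\<in>{u} \<times> P. score T0 Th A0 (p \<circ> \<eta>) b \<le> score T0 Th A0 (p \<circ> \<eta>) a"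
        by (auto simp: P_def score_dual_def)
    next
      assume le: "\<forall>(u, p)\<in>{u} \<times> P. score T0 Th A0 (p \<circ> \<eta>) b \<le> score T0 Th A0 (p \<circ> \<eta>) a"
      show "(a, b) \<in> R"
      proof (rule ccontr)
        assume "(a, b) \<notin> R"
        then obtain f where f: "f \<in> score_dual T0 Th A0 R"
          "score T0 Th A0 f a < score T0 Th A0 f b"
          using separating_score[OF assms(1,2,4-8) ab] by blast
        \<comment> \<open>Without coordinates there is no probability on \<open>F\<close>, but then
          all scores vanish and nothing can be separated.\<close>
        have "?I \<noteq> {}"
        proof
          assume "?I = {}"
          then have "score T0 Th A0 f a = 0" "score T0 Th A0 f b = 0" by (simp_all only: score_def sum.empty)
          with f(2) show False by simp
        qed
        \<comment> \<open>The summand 1 makes every \<open>f i + M\<close> strictly positive, and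
          with them the normalising factor \<open>Z\<close>.\<close>
        define M where "M = 1 + (\<Sum>i\<in>?I. \<bar>f i\<bar>)"
        have pos: "0 < f i + M" if "i \<in> ?I" for i
        proof -
          have "\<bar>f i\<bar> \<le> (\<Sum>i\<in>?I. \<bar>f i\<bar>)" using that finI by (intro member_le_sum) auto
          then show ?thesis by (simp add: M_def)
        qed
        define Z where "Z = (\<Sum>i\<in>?I. f i + M)"
        have "0 < Z" unfolding Z_def using finI \<open>?I \<noteq> {}\<close> pos by (rule sum_pos)
        define p where "p = (\<lambda>s. if s \<in> F then (f (inv_into ?I \<eta> s) + M) / Z else 0)"
        have p_\<eta>: "p (\<eta> i) = (f i + M) / Z" if "i \<in> ?I" for i
          using that \<eta>(1) unfolding p_def F_def by (subst if_P) auto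
        \<comment> \<open>By \<open>sum_choice_fun\<close> the constant \<open>M\<close> contributes
          once per atom, whatever the choice.\<close>
        have score_p: "score T0 Th A0 (p \<circ> \<eta>) d = (score T0 Th A0 f d + M * real (card ?At)) / Z"
          if "d \<in> C" for d
        proof -
          have d: "d \<in> choices T0 A0" using that assms(4) by blast
          have "score T0 Th A0 (p \<circ> \<eta>) d = score T0 Th A0 (\<lambda>i. (f i + M) / Z) d"
            using p_\<eta> by (intro score_cong) simp
          also have "\<dots> = (\<Sum>\<delta>\<in>?At. (\<Sum>c\<in>A0. f (\<delta>, c) * choice_fun T0 d \<delta> c)
              + M * (\<Sum>c\<in>A0. choice_fun T0 d \<delta> c)) / Z"
            unfolding score_eq sum_distrib_left sum.distrib[symmetric] sum_divide_distrib
            by (intro sum.cong refl) (simp add: algebra_simps)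
          also have "\<dots> = (score T0 Th A0 f d + M * real (card ?At)) / Z"
            unfolding sum_choice_fun[OF assms(2) d] score_eq sum.distrib by simp
          finally show ?thesis .
        qed
        have "p \<circ> \<eta> \<in> score_dual T0 Th A0 R"
          unfolding score_dual_def
        proof (clarify)
          fix d e assume de: "(d, e) \<in> R"
          then have "d \<in> C" "e \<in> C" "score T0 Th A0 f e \<le> score T0 Th A0 f d"
            using assms(6) f(1) by (auto simp: score_dual_def)
          then show "score T0 Th A0 (p \<circ> \<eta>) e \<le> score T0 Th A0 (p \<circ> \<eta>) d"
            using \<open>0 < Z\<close> by (simp add: score_p divide_right_mono)
        qed
        moreover have supp: "p s = 0" if "s \<notin> F" for s using that by (simp add: p_def)
        moreover have "0 \<le> p s" for s
        proof (cases "s \<in> F")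
          case True
          then obtain i where "i \<in> ?I" "s = \<eta> i" unfolding F_def by blast
          then show ?thesis using p_\<eta>[of i] pos[of i] \<open>0 < Z\<close> by simp
        qed (simp add: supp)
        moreover have "sum p F = 1"
        proof -
          have "sum p F = (\<Sum>i\<in>?I. (f i + M) / Z)"
            unfolding F_def sum.reindex[OF \<eta>(1)] using p_\<eta> by (intro sum.cong) auto
          also have "\<dots> = 1" unfolding sum_divide_distrib[symmetric] Z_def[symmetric]
            using \<open>0 < Z\<close> by simp
          finally show ?thesis .
        qed
        ultimately have "p \<in> P" unfolding P_eq by blast
        then have "score T0 Th A0 (p \<circ> \<eta>) b \<le> score T0 Th A0 (p \<circ> \<eta>) a" using le by auto
        then show False using f(2) \<open>0 < Z\<close> ab by (simp add: score_p divide_le_cancel)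
      qed
    qed
    show "{u} \<subseteq> utilities {0, 1}" by (auto simp: utilities_def u_def)
    show "P \<subseteq> prob_dists S" by (auto simp: P_def)
    show "p s = 0" if "p \<in> P" "s \<notin> F" for p s using that by (auto simp: P_def)
    show "closed ({u} \<times> P)" using \<open>closed P\<close> by (intro closed_Times) auto
  qed (use assms F \<open>closed P\<close> in \<open>auto simp: out_def\<close>)
  then show ?thesis by blast
qed

subsection \<open>Representations over the complete extensions\<close>

text \<open>Functions on an uncountable type are not a metric space, and the library has no \<open>t1_space\<close>
  instance for them.\<close>

lemma closed_finite_functions:
  fixes P :: "('a \<Rightarrow> real) set"
  assumes "finite P"
  shows "closed P"
proof -
  have "closed {q :: 'a \<Rightarrow> real. \<forall>s. q s = p s}" for p
    by (intro closed_Collect_all closed_Collect_eq continuous_on_const) simp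
  then have "closed {p}" for p :: "'a \<Rightarrow> real" by (simp add: fun_eq_iff[symmetric])
  then have "closed (\<Union>p\<in>P. {p})" using assms by (intro closed_UN) auto
  then show ?thesis by simp
qed

text \<open>The order of a single separating functional is itself a complete extension, with
  \<open>A3\<close> coming from the closedness of \<open>C\<close>. Inside
  \<open>C \<times> C\<close> the relation is therefore the intersection of its complete
  extensions.\<close>

lemma EX_AX_separates:
  assumes "finite T0" "finite A0" "C \<subseteq> choices T0 A0" "closed_choices T0 C" "mixture_closed C"
    and "R \<subseteq> C \<times> C" "A2_dagger T0 Th C R" "A3 T0 R"
    and "a \<in> C" "b \<in> C" "(a, b) \<notin> R"
  obtains R' where "R' \<in> EX_AX T0 Th C R" "(a, b) \<notin> R'"
proof -
  obtain f where f: "f \<in> score_dual T0 Th A0 R" "score T0 Th A0 f a < score T0 Th A0 f b"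
    using separating_score[OF assms(1-3,5-11)] by blast
  have "score_pref T0 Th A0 C {f} \<in> EX_AX T0 Th C R"
    unfolding EX_AX_def
  proof (intro CollectI conjI A2_dagger_score_pref A3_score_pref assms(4))
    show "score_pref T0 Th A0 C {f} \<subseteq> C \<times> C" by (auto simp: score_pref_def)
    show "A1 C (score_pref T0 Th A0 C {f})" by (auto simp: A1_def score_pref_def)
    show "R \<subseteq> score_pref T0 Th A0 C {f}"
      using f(1) assms(6) by (auto simp: score_pref_def score_dual_def)
  qed
  moreover have "(a, b) \<notin> score_pref T0 Th A0 C {f}" using f(2) by (simp add: score_pref_def)
  ultimately show ?thesis by (rule that)
qed

text \<open>A finite outcome space cannot separate infinitely many extensions, so this only works for
  finitely many of them; otherwise \<open>At \<times> EX\<close> has room for the bets of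
  \<open>bet_state_representation\<close>.\<close>

lemma finite_extension_representation:
  fixes R :: "('p, 'c) pref"
  assumes "finite T0" "finite A0" "Th \<subseteq> tests T0" "C \<subseteq> choices T0 A0" "closed_choices T0 C"
    and "mixture_closed C" "R \<subseteq> C \<times> C" "A2_dagger T0 Th C R" "A3 T0 R"
    and "finite (EX_AX T0 Th C R)"
  shows "\<exists>(Out::nat set) u P V \<pi> \<rho>0. SEU_representation T0 A0 Th C R
    (consistent_atoms T0 Th \<times> EX_AX T0 Th C R) Out {u} P V \<pi> \<rho>0"
proof -
  let ?At = "consistent_atoms T0 Th" and ?EX = "EX_AX T0 Th C R"
  let ?S = "?At \<times> ?EX"
  have fin: "finite ?At" using assms(1) by (rule finite_consistent_atoms)
  have "\<forall>R'\<in>?EX. \<exists>f. R' = score_pref T0 Th A0 C {f}"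
  proof
    fix R' assume "R' \<in> ?EX"
    then have "R' \<subseteq> C \<times> C" "A2_dagger T0 Th C R'" "A3 T0 R'" "A1 C R'"
      by (auto simp: EX_AX_def)
    then show "\<exists>f. R' = score_pref T0 Th A0 C {f}"
      using complete_score_pref[OF assms(1,2,4,6)] by metis
  qed
  then obtain f where f: "\<And>R'. R' \<in> ?EX \<Longrightarrow> R' = score_pref T0 Th A0 C {f R'}" by metis
  have finI: "finite (?S \<times> A0)" using fin assms(2,10) by simp
  obtain h :: "_ \<Rightarrow> nat" where h: "inj_on h (?S \<times> A0)"
    using finite_imp_inj_to_nat_seg[OF finI] by blast
  define Out where "Out = h ` (?S \<times> A0)"
  \<comment> \<open>Outcomes record the extension too, so one utility stores the functionals of all
    extensions. The probability \<open>p R'\<close>, uniform on the slice of \<open>R'\<close>,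
    reads off the functional of \<open>R'\<close>.\<close>
  define u where "u = (\<lambda>x. if x \<in> Out
    then case inv_into (?S \<times> A0) h x of ((\<delta>, R'), c) \<Rightarrow> f R' (\<delta>, c) else 0)"
  have u: "u (h ((\<delta>, R'), c)) = f R' (\<delta>, c)" if "\<delta> \<in> ?At" "R' \<in> ?EX" "c \<in> A0" for \<delta> R' c
  proof -
    have i: "((\<delta>, R'), c) \<in> ?S \<times> A0" using that by simp
    show ?thesis unfolding u_def Out_def using inv_into_f_f[OF h i] i by simp
  qed
  define N where "N = real (card ?At)"
  define p where "p = (\<lambda>(R' :: ('p, 'c) pref) (\<delta>, R''). if \<delta> \<in> ?At \<and> R'' = R' then 1 / N else 0)"
  define P where "P = {p R' | R'. R' \<in> ?EX \<and> ?At \<noteq> {}}"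
  have "finite P" using assms(10) by (auto simp: P_def)
  have supp: "q s = 0" if "q \<in> P" "s \<notin> ?S" for q s
    using that by (auto simp: P_def p_def split: prod.splits if_splits)
  have N: "0 < N" if "?At \<noteq> {}" using that fin by (simp add: N_def card_gt_0_iff)
  have sum_S: "(\<Sum>s\<in>?S. p R' s * g s) = (\<Sum>\<delta>\<in>?At. 1 / N * g (\<delta>, R'))" if "R' \<in> ?EX" for R' g
  proof -
    have "(\<Sum>s\<in>?S. p R' s * g s) = (\<Sum>\<delta>\<in>?At. \<Sum>R''\<in>?EX. p R' (\<delta>, R'') * g (\<delta>, R''))"
      by (simp add: sum.cartesian_product)
    also have "\<dots> = (\<Sum>\<delta>\<in>?At. \<Sum>R''\<in>?EX. if R'' = R' then 1 / N * g (\<delta>, R') else 0)"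
      by (intro sum.cong refl) (auto simp: p_def)
    also have "\<dots> = (\<Sum>\<delta>\<in>?At. 1 / N * g (\<delta>, R'))" using that assms(10) by simp
    finally show ?thesis .
  qed
  have "SEU_representation T0 A0 Th C R ?S Out {u} P ({u} \<times> P)
      (\<lambda>t. {s\<in>?S. entails T0 (fst s) t}) (\<lambda>c s. indicator {h (s, c)})"
  proof (rule SEU_representationI[where F = ?S and E = "\<lambda>u q a. \<Sum>s\<in>?S. \<Sum>c\<in>A0. q s * u (h (s, c)) * choice_fun T0 a (fst s) c"])
    show "P \<subseteq> prob_dists ?S"
    proof
      fix q assume q: "q \<in> P"
      then obtain R' where R': "q = p R'" "R' \<in> ?EX" "?At \<noteq> {}" by (auto simp: P_def)
      have "sum q ?S = 1"
        using sum_S[OF R'(2), of "\<lambda>_. 1"] N[OF R'(3)] R'(1) by (simp add: N_def)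
      moreover have "0 \<le> q s" for s by (auto simp: R'(1) p_def N_def split: prod.splits)
      ultimately show "q \<in> prob_dists ?S"
        using prob_dists_iff[of ?S ?S q] fin assms(10) supp[OF q] by auto
    qed
    show "(a, b) \<in> R \<longleftrightarrow> (\<forall>(u, q)\<in>{u} \<times> P.
        (\<Sum>s\<in>?S. \<Sum>c\<in>A0. q s * u (h (s, c)) * choice_fun T0 b (fst s) c)
        \<le> (\<Sum>s\<in>?S. \<Sum>c\<in>A0. q s * u (h (s, c)) * choice_fun T0 a (fst s) c))"
      if ab: "a \<in> C" "b \<in> C" for a b
    proof -
      define E where "E = (\<lambda>q a. \<Sum>s\<in>?S. \<Sum>c\<in>A0. q s * u (h (s, c)) * choice_fun T0 a (fst s) c)"
      have E: "E (p R') d = 1 / N * score T0 Th A0 (f R') d" if "R' \<in> ?EX" for R' d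
      proof -
        have "E (p R') d = (\<Sum>s\<in>?S. p R' s * (\<Sum>c\<in>A0. u (h (s, c)) * choice_fun T0 d (fst s) c))"
          unfolding E_def by (simp add: sum_distrib_left mult.assoc)
        also have "\<dots> = 1 / N * score T0 Th A0 (f R') d"
        proof -
          have "(\<Sum>\<delta>\<in>?At. \<Sum>c\<in>A0. u (h ((\<delta>, R'), c)) * choice_fun T0 d (fst (\<delta>, R')) c)
              = score T0 Th A0 (f R') d"
            unfolding score_eq using that by (intro sum.cong refl) (simp add: u)
          then show ?thesis unfolding sum_S[OF that] sum_distrib_left[symmetric] by simp
        qed
        finally show ?thesis .
      qed
      have "(a, b) \<in> R \<longleftrightarrow> (\<forall>q\<in>P. E q b \<le> E q a)"
      proof
        assume "(a, b) \<in> R"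
        show "\<forall>q\<in>P. E q b \<le> E q a"
        proof
          fix q assume "q \<in> P"
          then obtain R' where R': "q = p R'" "R' \<in> ?EX" "?At \<noteq> {}" by (auto simp: P_def)
          have "(a, b) \<in> R'" using \<open>(a, b) \<in> R\<close> R'(2) by (auto simp: EX_AX_def)
          then have "(a, b) \<in> score_pref T0 Th A0 C {f R'}" using f[OF R'(2)] by simp
          then show "E q b \<le> E q a"
            using N[OF R'(3)] by (simp add: score_pref_def R'(1) E[OF R'(2)] divide_right_mono)
        qed
      next
        assume le: "\<forall>q\<in>P. E q b \<le> E q a"
        show "(a, b) \<in> R"
        proof (rule ccontr)
          assume "(a, b) \<notin> R"
          then obtain R' where R': "R' \<in> ?EX" "(a, b) \<notin> R'"
            using EX_AX_separates[OF assms(1,2,4-9) ab] by blast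
          then have "(a, b) \<notin> score_pref T0 Th A0 C {f R'}" using f[OF R'(1)] by simp
          then have less: "score T0 Th A0 (f R') a < score T0 Th A0 (f R') b"
            using ab by (simp add: score_pref_def)
          have "?At \<noteq> {}"
          proof
            assume "?At = {}"
            with less show False by (simp add: score_eq)
          qed
          then have "p R' \<in> P" using R'(1) by (auto simp: P_def)
          with le have "E (p R') b \<le> E (p R') a" by blast
          then show False using less N[OF \<open>?At \<noteq> {}\<close>] by (simp add: E[OF R'(1)] divide_le_cancel)
        qed
      qed
      then show ?thesis by (simp add: E_def)
    qed
    show "closed P" by (rule closed_finite_functions[OF \<open>finite P\<close>])
    then show "closed ({u} \<times> P)" by (intro closed_Times closed_singleton)
    show "q s = 0" if "q \<in> P" "s \<notin> ?S" for q s using supp that by blast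
    show "{u} \<subseteq> utilities Out" by (auto simp: utilities_def u_def)
    show "fst s \<in> ?At" if "s \<in> ?S" for s using that by auto
    show "h (s, c) \<in> Out" if "s \<in> ?S" "c \<in> A0" for s c using that unfolding Out_def by blast
    show "finite Out" using finI by (simp add: Out_def)
    show "finite ?S" using fin assms(10) by simp
  qed (use assms in auto)
  then show ?thesis by blast
qed

lemma extension_state_representation:
  assumes "finite T0" "finite A0" "Th \<subseteq> tests T0" "C \<subseteq> choices T0 A0" "closed_choices T0 C"
    and "mixture_closed C" "R \<subseteq> C \<times> C" "A2_dagger T0 Th C R" "A3 T0 R"
  shows "\<exists>(Out::nat set) u P V \<pi> \<rho>0. SEU_representation T0 A0 Th C R
    (consistent_atoms T0 Th \<times> EX_AX T0 Th C R) Out {u} P V \<pi> \<rho>0"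
proof (cases "finite (EX_AX T0 Th C R)")
  case True
  then show ?thesis using finite_extension_representation assms by blast
next
  case False
  \<comment> \<open>As many extensions as primitive choices suffice: the state
    \<open>(\<delta>, j c)\<close> is the bet on \<open>c\<close> at \<open>\<delta>\<close>, and
    the extension \<open>j c\<close> is a mere label.\<close>
  then obtain B where "B \<subseteq> EX_AX T0 Th C R" "finite B" "card B = card A0"
    using infinite_arbitrarily_large by blast
  moreover from this obtain j where "bij_betw j A0 B"
    using finite_same_card_bij[OF assms(2)] by metis
  ultimately have j: "inj_on j A0" "j ` A0 \<subseteq> EX_AX T0 Th C R" by (auto simp: bij_betw_def)
  show ?thesis
    by (rule bet_state_representation[OF assms(1-4,6-9),
          where \<eta> = "\<lambda>(\<delta>, c). (\<delta>, j c)" and \<alpha> = fst])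
      (use j in \<open>auto simp: inj_on_def\<close>)
qed

lemma finite_bet_state_representation:
  assumes "finite T0" "finite A0" "Th \<subseteq> tests T0" "C \<subseteq> choices T0 A0" "mixture_closed C"
    and "R \<subseteq> C \<times> C" "A2_dagger T0 Th C R" "A3 T0 R"
  shows "\<exists>(S::nat set) (Out::nat set) u P V \<pi> \<rho>0.
    finite S \<and> SEU_representation T0 A0 Th C R S Out {u} P V \<pi> \<rho>0"
proof -
  let ?I = "consistent_atoms T0 Th \<times> A0"
  have finI: "finite ?I" using finite_consistent_atoms assms(1,2) by blast
  obtain h :: "_ \<Rightarrow> nat" where h: "inj_on h ?I" using finite_imp_inj_to_nat_seg[OF finI] by blast
  have "\<exists>(Out::nat set) u P V \<pi> \<rho>0. SEU_representation T0 A0 Th C R (h ` ?I) Out {u} P V \<pi> \<rho>0"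
  proof (rule bet_state_representation[OF assms, where \<eta> = h and \<alpha> = "\<lambda>s. fst (inv_into ?I h s)"])
    show "fst (inv_into ?I h s) \<in> consistent_atoms T0 Th" if "s \<in> h ` ?I" for s
      using inv_into_into[OF that] by auto
    show "fst (inv_into ?I h (h (\<delta>, c))) = \<delta>" if "\<delta> \<in> consistent_atoms T0 Th" "c \<in> A0" for \<delta> c
      using inv_into_f_f[OF h, of "(\<delta>, c)"] that by simp
  qed (use h in auto)
  then show ?thesis using finI by blast
qed

text \<open>Utilities pulled back along a numbering of the coordinates prescribe a functional only
  there, while members of the dual are arbitrary elsewhere; scores ignore the difference.\<close>

lemma score_pref_cong:
  assumes "\<And>f. f \<in> L \<Longrightarrow> \<exists>g\<in>L'. \<forall>i\<in>consistent_atoms T0 Th \<times> A0. g i = f i"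
    and "\<And>g. g \<in> L' \<Longrightarrow> \<exists>f\<in>L. \<forall>i\<in>consistent_atoms T0 Th \<times> A0. f i = g i"
  shows "score_pref T0 Th A0 C L = score_pref T0 Th A0 C L'"
proof -
  have 1: "\<exists>g\<in>L'. score T0 Th A0 g = score T0 Th A0 f" if f: "f \<in> L" for f
    using assms(1)[OF f] score_cong[of T0 Th A0 _ f] by blast
  have 2: "\<exists>f\<in>L. score T0 Th A0 f = score T0 Th A0 g" if g: "g \<in> L'" for g
    using assms(2)[OF g] score_cong[of T0 Th A0 _ g] by blast
  have image: "score T0 Th A0 ` L = score T0 Th A0 ` L'"
  proof (intro Set.equalityI image_subsetI)
    show "score T0 Th A0 f \<in> score T0 Th A0 ` L'" if "f \<in> L" for f
      using 1[OF that] by (metis imageI)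
    show "score T0 Th A0 g \<in> score T0 Th A0 ` L" if "g \<in> L'" for g
      using 2[OF that] by (metis imageI)
  qed
  have "score_pref T0 Th A0 C L = {(a, b) \<in> C \<times> C. \<forall>v\<in>score T0 Th A0 ` L. v b \<le> v a}" for L
    by (simp add: score_pref_def)
  then show ?thesis using image by (simp only:)
qed

lemma transported_functional:
  fixes h :: "'i \<Rightarrow> nat"
  assumes "inj_on h I"
  obtains u where "u \<in> utilities (h ` I)" "\<forall>i\<in>I. (u \<circ> h) i = f i"
proof
  let ?u = "\<lambda>x. if x \<in> h ` I then f (inv_into I h x) else 0"
  show "?u \<in> utilities (h ` I)" by (auto simp: utilities_def)
  show "\<forall>i\<in>I. (?u \<circ> h) i = f i" using inv_into_f_f[OF assms] by simp
qed

text \<open>Every state of an interpretation consistent with \<open>Th\<close> determines a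
  consistent atom. If there is none, the state space is empty and carries no probability, so a
  single probability or a single pair cannot be demanded; the set \<open>V\<close> of any
  representation is then empty and \<open>R\<close> is all of \<open>C \<times> C\<close>.\<close>

theorem theorem3:
  fixes T0 :: "'p set" and A0 :: "'c set" and Th :: "'p test set"
    and C :: "('p, 'c) choice set" and R :: "('p, 'c) pref"
  assumes "finite T0" and "finite A0" and "Th \<subseteq> tests T0"
    and "C \<subseteq> choices T0 A0" and "closed_choices T0 C" and "mixture_closed C"
    and "R \<subseteq> C \<times> C"
  shows "(has_SEU_representation T0 A0 Th C R \<longleftrightarrow> A2_dagger T0 Th C R \<and> A3 T0 R) \<and>
    (has_SEU_representation T0 A0 Th C R \<longrightarrow>
      (consistent_atoms T0 Th \<noteq> {} \<longrightarrow>
        (\<exists>(S::nat set) (Out::nat set) U p V \<pi> \<rho>0.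
           finite S \<and> SEU_representation T0 A0 Th C R S Out U {p} V \<pi> \<rho>0)) \<and>
      (\<exists>(S::nat set) (Out::nat set) u P V \<pi> \<rho>0.
         finite S \<and> SEU_representation T0 A0 Th C R S Out {u} P V \<pi> \<rho>0) \<and>
      (\<exists>(Out::nat set) u P V \<pi> \<rho>0.
         SEU_representation T0 A0 Th C R
           (consistent_atoms T0 Th \<times> EX_AX T0 Th C R) Out {u} P V \<pi> \<rho>0) \<and>
      (A1 C R \<and> consistent_atoms T0 Th \<noteq> {} \<longrightarrow>
        (\<exists>(S::nat set) (Out::nat set) U P u p \<pi> \<rho>0.
           finite S \<and> SEU_representation T0 A0 Th C R S Out U P {(u, p)} \<pi> \<rho>0)))"
proof -
  let ?I = "consistent_atoms T0 Th \<times> A0"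
  have necessary: "A2_dagger T0 Th C R \<and> A3 T0 R" if "has_SEU_representation T0 A0 Th C R"
    using that unfolding has_SEU_representation_def
  proof (elim exE conjE)
    fix S Out :: "nat set" and U P V \<pi> \<rho>0
    assume rep: "finite S" "SEU_representation T0 A0 Th C R S Out U P V \<pi> \<rho>0"
    obtain L where "R = score_pref T0 Th A0 C L"
      by (rule SEU_representation_score_pref[OF assms(1-4,7) rep])
    then show ?thesis by (simp only: A2_dagger_score_pref A3_score_pref[OF assms(5)])
  qed
  have bets: "\<exists>(S::nat set) (Out::nat set) u P V \<pi> \<rho>0.
      finite S \<and> SEU_representation T0 A0 Th C R S Out {u} P V \<pi> \<rho>0"
    if "A2_dagger T0 Th C R" "A3 T0 R"
    by (rule finite_bet_state_representation[OF assms(1-4,6,7) that])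
  have uniform: "\<exists>(S::nat set) (Out::nat set) U p V \<pi> \<rho>0.
      finite S \<and> SEU_representation T0 A0 Th C R S Out U {p} V \<pi> \<rho>0"
    if AX: "A2_dagger T0 Th C R" "A3 T0 R" and ne: "consistent_atoms T0 Th \<noteq> {}"
  proof -
    obtain S Out :: "nat set" and h p \<pi> \<rho>0 where "finite S"
      and h: "inj_on h ?I" "h ` ?I = Out"
      and rep: "\<And>U. U \<subseteq> utilities Out \<Longrightarrow> closed U \<Longrightarrow> SEU_representation T0 A0 Th C
         (score_pref T0 Th A0 C ((\<lambda>u. u \<circ> h) ` U)) S Out U {p} (U \<times> {p}) \<pi> \<rho>0"
      by (rule uniform_state_representation[OF assms(1-4) ne]) (rule that)
    \<comment> \<open>Linear inequalities define this set, so it is closed, and on the coordinates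
      its pullback along \<open>h\<close> reaches every member of the dual.\<close>
    define U where "U = {u\<in>utilities Out. u \<circ> h \<in> score_dual T0 Th A0 R}"
    have "closed (utilities Out :: (nat \<Rightarrow> real) set)"
      unfolding utilities_def
      by (intro closed_Collect_all closed_Collect_imp open_Collect_const closed_Collect_eq
          continuous_on_const) simp
    moreover have "closed {u. u \<circ> h \<in> score_dual T0 Th A0 R}"
      by (intro closed_score_constraints) simp
    ultimately have "closed U" unfolding U_def Collect_conj_eq Collect_mem_eq by (rule closed_Int)
    have "score_pref T0 Th A0 C (score_dual T0 Th A0 R) = score_pref T0 Th A0 C ((\<lambda>u. u \<circ> h) ` U)"
    proof (rule score_pref_cong)
      fix f assume f: "f \<in> score_dual T0 Th A0 R"
      obtain u where u: "u \<in> utilities Out" "\<forall>i\<in>?I. (u \<circ> h) i = f i"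
        by (rule transported_functional[OF h(1), of f, unfolded h(2)])
      have "score T0 Th A0 (u \<circ> h) = score T0 Th A0 f"
        by (rule ext, rule score_cong) (use u(2) in blast)
      then have "u \<in> U" using f u(1) by (simp add: U_def score_dual_def)
      then show "\<exists>g\<in>(\<lambda>u. u \<circ> h) ` U. \<forall>i\<in>?I. g i = f i" using u(2) by blast
    qed (auto simp: U_def)
    then have "score_pref T0 Th A0 C ((\<lambda>u. u \<circ> h) ` U) = R"
      using score_pref_dual[OF assms(1,2,4,6,7) AX] by (simp only:)
    moreover have "U \<subseteq> utilities Out" by (auto simp: U_def)
    ultimately have "SEU_representation T0 A0 Th C R S Out U {p} (U \<times> {p}) \<pi> \<rho>0"
      using rep[of U] \<open>closed U\<close> by (simp only:)
    then show ?thesis using \<open>finite S\<close> by blast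
  qed
  have single: "\<exists>(S::nat set) (Out::nat set) U P u p \<pi> \<rho>0.
      finite S \<and> SEU_representation T0 A0 Th C R S Out U P {(u, p)} \<pi> \<rho>0"
    if AX: "A2_dagger T0 Th C R" "A3 T0 R" and "A1 C R" and ne: "consistent_atoms T0 Th \<noteq> {}"
  proof -
    obtain S Out :: "nat set" and h p \<pi> \<rho>0 where "finite S"
      and h: "inj_on h ?I" "h ` ?I = Out"
      and rep: "\<And>U. U \<subseteq> utilities Out \<Longrightarrow> closed U \<Longrightarrow> SEU_representation T0 A0 Th C
         (score_pref T0 Th A0 C ((\<lambda>u. u \<circ> h) ` U)) S Out U {p} (U \<times> {p}) \<pi> \<rho>0"
      by (rule uniform_state_representation[OF assms(1-4) ne]) (rule that)
    obtain f where f: "R = score_pref T0 Th A0 C {f}"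
      using complete_score_pref[OF assms(1,2,4,6,7) AX \<open>A1 C R\<close>] by blast
    obtain u where u: "u \<in> utilities Out" "\<forall>i\<in>?I. (u \<circ> h) i = f i"
      by (rule transported_functional[OF h(1), of f, unfolded h(2)])
    have "score_pref T0 Th A0 C {f} = score_pref T0 Th A0 C ((\<lambda>u. u \<circ> h) ` {u})"
      using u(2) by (intro score_pref_cong) auto
    then have eq: "score_pref T0 Th A0 C ((\<lambda>u. u \<circ> h) ` {u}) = R" by (simp only: f)
    have "{u} \<subseteq> utilities Out" using u(1) by simp
    from rep[OF this] have "SEU_representation T0 A0 Th C R S Out {u} {p} ({u} \<times> {p}) \<pi> \<rho>0"
      unfolding eq by simp
    then have "SEU_representation T0 A0 Th C R S Out {u} {p} {(u, p)} \<pi> \<rho>0" by simp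
    then show ?thesis using \<open>finite S\<close> by blast
  qed
  have "has_SEU_representation T0 A0 Th C R" if "A2_dagger T0 Th C R" "A3 T0 R"
    using bets[OF that] unfolding has_SEU_representation_def by (elim exE) (intro exI)
  with necessary have iff: "has_SEU_representation T0 A0 Th C R \<longleftrightarrow> A2_dagger T0 Th C R \<and> A3 T0 R"
    by blast
  show ?thesis
  proof (intro conjI impI iff)
    assume "has_SEU_representation T0 A0 Th C R"
    then have AX: "A2_dagger T0 Th C R" "A3 T0 R" using iff by blast+
    note res = uniform[OF AX] bets[OF AX] extension_state_representation[OF assms AX] single[OF AX]
    show "\<exists>(S::nat set) (Out::nat set) U p V \<pi> \<rho>0.
        finite S \<and> SEU_representation T0 A0 Th C R S Out U {p} V \<pi> \<rho>0"
      if "consistent_atoms T0 Th \<noteq> {}" by (rule res(1)[OF that])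
    show "\<exists>(S::nat set) (Out::nat set) u P V \<pi> \<rho>0.
        finite S \<and> SEU_representation T0 A0 Th C R S Out {u} P V \<pi> \<rho>0" by (rule res(2))
    show "\<exists>(Out::nat set) u P V \<pi> \<rho>0. SEU_representation T0 A0 Th C R
        (consistent_atoms T0 Th \<times> EX_AX T0 Th C R) Out {u} P V \<pi> \<rho>0" by (rule res(3))
    show "\<exists>(S::nat set) (Out::nat set) U P u p \<pi> \<rho>0.
        finite S \<and> SEU_representation T0 A0 Th C R S Out U P {(u, p)} \<pi> \<rho>0"
      if "A1 C R \<and> consistent_atoms T0 Th \<noteq> {}" using res(4) that by blast
  qed
qed

end
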